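(* Let $X$ be a Riemann surface, let $n\ge 1$ be an integer, and let $f:\mathbb{D}\to \mathrm{Sym}^n(X)$ be holomorphic. Then $$\Big(\mathcal{H}_{\mathcal{M}_X}\big(\pi_{\mathrm{Sym}}^{-1}(f(x)),\ \pi_{\mathrm{Sym}}^{-1}(f(x_0))\big)\Big)^n \le \mathcal{M}_{\mathbb{D}}(x,x_0)\qquad \text{for all } x,x_0\in\mathbb{D}.$$
   Context: $\mathbb{D}$ is the open unit disk in $\mathbb{C}$. All complex manifolds (in particular Riemann surfaces) are connected. $\mathcal{O}(X,Y)$ denotes the set of holomorphic maps from $X$ to $Y$. Möbius pseudodistance: for a complex manifold $X$, $\mathcal{M}_X(z_1,z_2):=\sup\{|f(z_1)| : f\in\mathcal{O}(X,\mathbb{D}),\ f(z_2)=0\}$ for $z_1,z_2\in X$. (It may vanish at pairs of distinct points, or identically.) Hausdorff pseudodistance: for non-empty finite sets $A,B\subset X$, $\mathcal{H}_{\mathcal{M}_X}(A,B):=\max\{\max_{a\in A}\min_{b\in B}\mathcal{M}_X(a,b),\ \max_{b\in B}\min_{a\in A}\mathcal{M}_X(a,b)\}$. Symmetric product: $\mathrm{Sym}^n(X):=X^n/S_n$, where $S_n$ permutes entries; $\langle x_1,\dots,x_n\rangle$ is the class of $(x_1,\dots,x_n)$ and $\pi_{\mathrm{Sym}}:X^n\to\mathrm{Sym}^n(X)$ is the quotient map. It is an $n$-dimensional complex manifold with the following charts: near $p=\langle p_1,\dots,p_n\rangle$ choose holomorphic charts $(U_j,\varphi_j)$ of $X$ at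 $p_j$, equal when $p_j=p_k$, and with $U_j\cap U_k=\emptyset$ and $\varphi_j(U_j)\cap\varphi_k(U_k)=\emptyset$ when $p_j\ne p_k$; the chart on $\langle U_1,\dots,U_n\rangle=\{\langle x_1,\dots,x_n\rangle: x_j\in U_j\}$ is $\langle x_1,\dots,x_n\rangle\mapsto(\sigma_1(\varphi_1(x_1),\dots,\varphi_n(x_n)),\dots,\sigma_n(\varphi_1(x_1),\dots,\varphi_n(x_n)))$ (with $x_j\in U_j$), $\sigma_j$ being the $j$-th elementary symmetric polynomial. With this structure $\pi_{\mathrm{Sym}}$ is a proper holomorphic map. For $p=\langle p_1,\dots,p_n\rangle\in\mathrm{Sym}^n(X)$, $\pi_{\mathrm{Sym}}^{-1}(p)$ denotes the subset $\{p_1,\dots,p_n\}$ of $X$ (not the fibre in $X^n$). *)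

theory Defs
  imports "HOL-Complex_Analysis.Complex_Analysis" "HOL-Combinatorics.Permutations"
begin

section \<open>Riemann surfaces\<close>

text \<open>
  A topological space together with an atlas. A chart is a pair \<open>(U, \<phi>)\<close> of a domain and a
  coordinate map, of which only the values on \<open>U\<close> matter. The values of the charts are of type
  \<open>complex\<close> for Riemann surfaces, and of type \<open>nat \<Rightarrow> complex\<close> (coordinates with indices
  \<open>1, \<dots>, n\<close>) for \<open>n\<close>-dimensional manifolds.
\<close>

record ('a, 'c) charted =
  topol :: "'a topology"
  atlas :: "('a set \<times> ('a \<Rightarrow> 'c)) set"

type_synonym 'a surface = "('a, complex) charted"

definition is_chart :: "'a topology \<Rightarrow> 'a set \<Rightarrow> ('a \<Rightarrow> complex) \<Rightarrow> bool" where
  "is_chart T U \<phi> \<longleftrightarrow>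
     openin T U \<and> open (\<phi> ` U) \<and>
     homeomorphic_map (subtopology T U) (top_of_set (\<phi> ` U)) \<phi>"

definition compatible ::
    "'a set \<Rightarrow> ('a \<Rightarrow> complex) \<Rightarrow> 'a set \<Rightarrow> ('a \<Rightarrow> complex) \<Rightarrow> bool" where
  "compatible U \<phi> V \<psi> \<longleftrightarrow>
     (\<psi> \<circ> inv_into U \<phi>) holomorphic_on \<phi> ` (U \<inter> V) \<and>
     (\<phi> \<circ> inv_into V \<psi>) holomorphic_on \<psi> ` (U \<inter> V)"

definition riemann_surface :: "'a surface \<Rightarrow> bool" where
  "riemann_surface X \<longleftrightarrow>
     Hausdorff_space (topol X) \<and> connected_space (topol X) \<and> topspace (topol X) \<noteq> {} \<and>
     (\<Union>(U, \<phi>)\<in>atlas X. U) = topspace (topol X) \<and>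
     (\<forall>(U, \<phi>)\<in>atlas X. is_chart (topol X) U \<phi>) \<and>
     (\<forall>(U, \<phi>)\<in>atlas X. \<forall>(V, \<psi>)\<in>atlas X. compatible U \<phi> V \<psi>)"

text \<open>The charts of the maximal atlas generated by \<^term>\<open>atlas X\<close>.\<close>

definition holomorphic_chart :: "'a surface \<Rightarrow> 'a set \<Rightarrow> ('a \<Rightarrow> complex) \<Rightarrow> bool" where
  "holomorphic_chart X U \<phi> \<longleftrightarrow>
     is_chart (topol X) U \<phi> \<and> (\<forall>(V, \<psi>)\<in>atlas X. compatible U \<phi> V \<psi>)"

definition disc :: "complex surface" where
  "disc = \<lparr>topol = top_of_set (ball 0 1), atlas = {(ball 0 1, \<lambda>z. z)}\<rparr>"


section \<open>Holomorphic maps\<close>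

text \<open>
  Maps out of a Riemann surface that are continuous and holomorphic in all charts, where \<open>C\<close> is the
  set of coordinate functions on the space in which the charts of \<open>Y\<close> take their values.
  Since maps are total functions, they are arbitrary outside the underlying space of \<open>X\<close>.
\<close>

definition holomorphic_maps_wrt ::
    "('c \<Rightarrow> complex) set \<Rightarrow> 'a surface \<Rightarrow> ('b, 'c) charted \<Rightarrow> ('a \<Rightarrow> 'b) set" where
  "holomorphic_maps_wrt C X Y =
     {f. continuous_map (topol X) (topol Y) f \<and>
         (\<forall>(U, \<phi>)\<in>atlas X. \<forall>(V, \<psi>)\<in>atlas Y. \<forall>c\<in>C.
            (c \<circ> \<psi> \<circ> f \<circ> inv_into U \<phi>) holomorphic_on \<phi> ` {x \<in> U. f x \<in> V})}"

definition holomorphic_maps :: "'a surface \<Rightarrow> 'b surface \<Rightarrow> ('a \<Rightarrow> 'b) set" where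
  "holomorphic_maps X Y = holomorphic_maps_wrt {\<lambda>w. w} X Y"

definition holomorphic_maps_dim ::
    "nat \<Rightarrow> 'a surface \<Rightarrow> ('b, nat \<Rightarrow> complex) charted \<Rightarrow> ('a \<Rightarrow> 'b) set" where
  "holomorphic_maps_dim n X Y = holomorphic_maps_wrt {\<lambda>w. w k | k. k \<in> {1..n}} X Y"


section \<open>The Moebius and Hausdorff pseudodistances\<close>

definition moebius_dist :: "'a surface \<Rightarrow> 'a \<Rightarrow> 'a \<Rightarrow> real" where
  "moebius_dist X z1 z2 = Sup {cmod (f z1) | f. f \<in> holomorphic_maps X disc \<and> f z2 = 0}"

definition hausdorff_dist :: "('a \<Rightarrow> 'a \<Rightarrow> real) \<Rightarrow> 'a set \<Rightarrow> 'a set \<Rightarrow> real" where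
  "hausdorff_dist d A B =
     max (Max ((\<lambda>a. Min ((\<lambda>b. d a b) ` B)) ` A))
         (Max ((\<lambda>b. Min ((\<lambda>a. d a b) ` A)) ` B))"


section \<open>Symmetric products\<close>

text \<open>
  The orbit of \<open>(x\<^sub>1, \<dots>, x\<^sub>n)\<close> under permutation of the entries is represented by the multiset of the
  entries. The lemmas \<open>sym_proj_eq_iff\<close>, \<open>sym_proj_image\<close> and \<open>quotient_map_sym_proj\<close> below show
  that this is the quotient of the \<open>n\<close>-fold product by the symmetric group. The set of entries of
  an orbit \<open>p\<close> is \<^term>\<open>set_mset p\<close>.
\<close>

definition sym_proj :: "nat \<Rightarrow> (nat \<Rightarrow> 'a) \<Rightarrow> 'a multiset" where
  "sym_proj n x = image_mset x (mset_set {1..n})"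

definition power_topology :: "nat \<Rightarrow> 'a topology \<Rightarrow> (nat \<Rightarrow> 'a) topology" where
  "power_topology n T = product_topology (\<lambda>_. T) {1..n}"

definition sym_points :: "nat \<Rightarrow> 'a set \<Rightarrow> 'a multiset set" where
  "sym_points n S = {p. size p = n \<and> set_mset p \<subseteq> S}"

definition sym_topology :: "nat \<Rightarrow> 'a topology \<Rightarrow> 'a multiset topology" where
  "sym_topology n T = topology (\<lambda>W. W \<subseteq> sym_points n (topspace T) \<and>
     openin (power_topology n T) {x \<in> topspace (power_topology n T). sym_proj n x \<in> W})"

definition elem_sym :: "nat \<Rightarrow> nat \<Rightarrow> (nat \<Rightarrow> complex) \<Rightarrow> complex" where
  "elem_sym n k z = (\<Sum>S | S \<subseteq> {1..n} \<and> card S = k. \<Prod>j\<in>S. z j)"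

definition sym_nbhd :: "nat \<Rightarrow> (nat \<Rightarrow> 'a set) \<Rightarrow> 'a multiset set" where
  "sym_nbhd n U = {sym_proj n x | x. \<forall>j\<in>{1..n}. x j \<in> U j}"

text \<open>
  The \<open>k\<close>-th coordinate of a point \<open>q\<close> is computed from any representative \<open>x\<close> of \<open>q\<close> with
  \<open>x\<^sub>j \<in> U\<^sub>j\<close>; the choice of \<open>x\<close> is irrelevant by lemma \<open>sym_chart_sym_proj\<close> below.
\<close>

definition sym_chart ::
    "nat \<Rightarrow> (nat \<Rightarrow> 'a set) \<Rightarrow> (nat \<Rightarrow> 'a \<Rightarrow> complex) \<Rightarrow> 'a multiset \<Rightarrow> nat \<Rightarrow> complex" where
  "sym_chart n U \<phi> q k =
     (let x = (SOME x. (\<forall>j\<in>{1..n}. x j \<in> U j) \<and> sym_proj n x = q)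
      in elem_sym n k (\<lambda>j. \<phi> j (x j)))"

definition sym_chart_family ::
    "nat \<Rightarrow> 'a surface \<Rightarrow> (nat \<Rightarrow> 'a) \<Rightarrow> (nat \<Rightarrow> 'a set) \<Rightarrow> (nat \<Rightarrow> 'a \<Rightarrow> complex) \<Rightarrow> bool" where
  "sym_chart_family n X p U \<phi> \<longleftrightarrow>
     (\<forall>j\<in>{1..n}. holomorphic_chart X (U j) (\<phi> j) \<and> p j \<in> U j) \<and>
     (\<forall>j\<in>{1..n}. \<forall>k\<in>{1..n}.
        if p j = p k then U j = U k \<and> \<phi> j = \<phi> k
        else U j \<inter> U k = {} \<and> \<phi> j ` U j \<inter> \<phi> k ` U k = {})"

definition Sym :: "nat \<Rightarrow> 'a surface \<Rightarrow> ('a multiset, nat \<Rightarrow> complex) charted" where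
  "Sym n X =
     \<lparr>topol = sym_topology n (topol X),
      atlas = {(sym_nbhd n U, sym_chart n U \<phi>) | p U \<phi>. sym_chart_family n X p U \<phi>}\<rparr>"


section \<open>Consistency of the definitions\<close>

lemma riemann_surface_disc: "riemann_surface disc"
proof -
  have "inv_into (ball 0 1) (\<lambda>z. z) z = z" if "z \<in> ball 0 1" for z :: complex
    using that by (intro inv_into_f_f) (auto simp: inj_on_def)
  hence "(\<lambda>z::complex. inv_into (ball 0 1) (\<lambda>z. z) z) holomorphic_on ball 0 1"
    by (intro holomorphic_transform[OF holomorphic_on_ident]) auto
  moreover have "homeomorphic_map (top_of_set (ball (0::complex) 1)) (top_of_set (ball 0 1)) (\<lambda>z. z)"
    using homeomorphic_map_id[of "top_of_set (ball (0::complex) 1)" "top_of_set (ball 0 1)"]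
    by (simp add: id_def)
  ultimately show ?thesis
    by (auto simp: riemann_surface_def disc_def is_chart_def compatible_def o_def
        Hausdorff_space_subtopology Hausdorff_space_euclidean connected_space_subtopology
        subtopology_subtopology)
qed

lemma sym_proj_eq_iff:
  "sym_proj n x = sym_proj n y \<longleftrightarrow> (\<exists>\<pi>. \<pi> permutes {1..n} \<and> (\<forall>j\<in>{1..n}. x j = y (\<pi> j)))"
proof
  assume "sym_proj n x = sym_proj n y"
  hence "image_mset x (mset_set {1..n}) = image_mset y (mset_set {1..n})"
    by (simp add: sym_proj_def)
  from image_mset_eq_implies_permutes[OF finite_atLeastAtMost this]
  obtain \<pi> where "\<pi> permutes {1..n}" "\<forall>j\<in>{1..n}. x j = y (\<pi> j)" by blast
  thus "\<exists>\<pi>. \<pi> permutes {1..n} \<and> (\<forall>j\<in>{1..n}. x j = y (\<pi> j))" by blast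
next
  assume "\<exists>\<pi>. \<pi> permutes {1..n} \<and> (\<forall>j\<in>{1..n}. x j = y (\<pi> j))"
  then obtain \<pi> where \<pi>: "\<pi> permutes {1..n}" "\<forall>j\<in>{1..n}. x j = y (\<pi> j)" by blast
  have "sym_proj n x = image_mset y (image_mset \<pi> (mset_set {1..n}))"
    using \<pi>(2) by (auto simp: sym_proj_def multiset.map_comp intro!: image_mset_cong)
  also have "image_mset \<pi> (mset_set {1..n}) = mset_set {1..n}"
    using \<pi>(1) by (simp add: image_mset_mset_set permutes_inj_on permutes_image)
  finally show "sym_proj n x = sym_proj n y" by (simp add: sym_proj_def)
qed

lemma sym_proj_image: "sym_proj n ` ({1..n} \<rightarrow>\<^sub>E S) = sym_points n S"
proof
  show "sym_proj n ` ({1..n} \<rightarrow>\<^sub>E S) \<subseteq> sym_points n S"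
    by (auto simp: sym_proj_def sym_points_def)
next
  show "sym_points n S \<subseteq> sym_proj n ` ({1..n} \<rightarrow>\<^sub>E S)"
  proof
    fix p assume p: "p \<in> sym_points n S"
    obtain xs where xs: "mset xs = p" by (metis ex_mset)
    have len: "length xs = n" and set: "set xs \<subseteq> S"
      using p xs by (auto simp: sym_points_def)
    define x where "x = restrict (\<lambda>j. xs ! (j - 1)) {1..n}"
    have "x \<in> {1..n} \<rightarrow>\<^sub>E S"
      using len set by (auto simp: x_def subset_iff)
    moreover have "sym_proj n x = p"
    proof -
      have "mset_set {1..n} = image_mset Suc (mset_set {0..<n})"
        by (simp add: image_mset_mset_set atLeastLessThanSuc_atLeastAtMost)
      hence "sym_proj n x = image_mset (\<lambda>j. xs ! j) (mset_set {0..<n})"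
        by (auto simp: sym_proj_def multiset.map_comp x_def intro!: image_mset_cong)
      also have "\<dots> = mset (map (\<lambda>j. xs ! j) [0..<n])" by simp
      also have "\<dots> = p" using len xs map_nth[of xs] by simp
      finally show ?thesis .
    qed
    ultimately show "p \<in> sym_proj n ` ({1..n} \<rightarrow>\<^sub>E S)" by blast
  qed
qed

lemma openin_sym_topology:
  "openin (sym_topology n T) W \<longleftrightarrow> W \<subseteq> sym_points n (topspace T) \<and>
     openin (power_topology n T) {x \<in> topspace (power_topology n T). sym_proj n x \<in> W}"
proof -
  let ?P = "power_topology n T"
  let ?A = "\<lambda>W. {x \<in> topspace ?P. sym_proj n x \<in> W}"
  have "istopology (\<lambda>W. W \<subseteq> sym_points n (topspace T) \<and> openin ?P (?A W))"
    unfolding istopology_def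
  proof (intro conjI allI impI; (elim conjE)?)
    fix V W assume "openin ?P (?A V)" "openin ?P (?A W)"
    moreover have "?A (V \<inter> W) = ?A V \<inter> ?A W" by auto
    ultimately show "openin ?P (?A (V \<inter> W))" by auto
  next
    fix \<K> assume "\<forall>K\<in>\<K>. K \<subseteq> sym_points n (topspace T) \<and> openin ?P (?A K)"
    moreover have "?A (\<Union>\<K>) = (\<Union>K\<in>\<K>. ?A K)" by auto
    ultimately show "openin ?P (?A (\<Union>\<K>))" by auto
  qed auto
  thus ?thesis unfolding sym_topology_def by (simp add: topology_inverse')
qed

lemma topspace_sym_topology: "topspace (sym_topology n T) = sym_points n (topspace T)"
proof -
  have "{x \<in> topspace (power_topology n T). sym_proj n x \<in> sym_points n (topspace T)} =
        topspace (power_topology n T)"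
    using sym_proj_image[of n "topspace T"] by (auto simp: power_topology_def)
  hence "openin (sym_topology n T) (sym_points n (topspace T))"
    by (simp add: openin_sym_topology)
  thus ?thesis
    by (meson openin_subset openin_sym_topology openin_topspace subset_antisym)
qed

lemma quotient_map_sym_proj:
  "quotient_map (power_topology n T) (sym_topology n T) (sym_proj n)"
  unfolding quotient_map_def topspace_sym_topology
  using sym_proj_image[of n "topspace T"]
  by (auto simp: openin_sym_topology power_topology_def)

lemma elem_sym_permute:
  assumes "\<pi> permutes {1..n}"
  shows "elem_sym n k (\<lambda>j. z (\<pi> j)) = elem_sym n k z"
proof -
  have inj: "inj \<pi>" using assms by (rule permutes_inj)
  have "bij_betw ((`) \<pi>) {S. S \<subseteq> {1..n} \<and> card S = k} {S. S \<subseteq> {1..n} \<and> card S = k}"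
  proof (rule bij_betwI[where g = "(`) (inv \<pi>)"])
    have *: "\<sigma> ` S \<subseteq> {1..n} \<and> card (\<sigma> ` S) = k"
      if "\<sigma> permutes {1..n}" "S \<subseteq> {1..n}" "card S = k" for \<sigma> S
      using that permutes_image[OF that(1)]
      by (metis card_image image_mono permutes_inj_on)
    show "(`) \<pi> \<in> {S. S \<subseteq> {1..n} \<and> card S = k} \<rightarrow> {S. S \<subseteq> {1..n} \<and> card S = k}"
      using *[OF assms] by blast
    show "(`) (inv \<pi>) \<in> {S. S \<subseteq> {1..n} \<and> card S = k} \<rightarrow> {S. S \<subseteq> {1..n} \<and> card S = k}"
      using *[OF permutes_inv[OF assms]] by blast
  qed (use assms in \<open>auto simp: image_image permutes_inverses\<close>)
  hence "(\<Sum>S | S \<subseteq> {1..n} \<and> card S = k. \<Prod>j\<in>\<pi> ` S. z j) = elem_sym n k z"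
    unfolding elem_sym_def by (rule sum.reindex_bij_betw)
  moreover have "(\<Prod>j\<in>\<pi> ` S. z j) = (\<Prod>j\<in>S. z (\<pi> j))" for S
    using prod.reindex[OF inj_on_subset[OF inj subset_UNIV], of z S] by (simp add: o_def)
  ultimately show ?thesis
    by (simp only: elem_sym_def)
qed

lemma sym_chart_sym_proj:
  assumes "sym_chart_family n X p U \<phi>" and x: "\<And>j. j \<in> {1..n} \<Longrightarrow> x j \<in> U j"
  shows "sym_chart n U \<phi> (sym_proj n x) k = elem_sym n k (\<lambda>j. \<phi> j (x j))"
proof -
  define y where "y = (SOME y. (\<forall>j\<in>{1..n}. y j \<in> U j) \<and> sym_proj n y = sym_proj n x)"
  have "(\<forall>j\<in>{1..n}. y j \<in> U j) \<and> sym_proj n y = sym_proj n x"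
    unfolding y_def by (rule someI[of _ x]) (use x in auto)
  hence y: "\<And>j. j \<in> {1..n} \<Longrightarrow> y j \<in> U j" and "sym_proj n y = sym_proj n x" by auto
  then obtain \<pi> where \<pi>: "\<pi> permutes {1..n}" "\<And>j. j \<in> {1..n} \<Longrightarrow> y j = x (\<pi> j)"
    unfolding sym_proj_eq_iff by blast
  have "\<phi> j (y j) = \<phi> (\<pi> j) (x (\<pi> j))" if j: "j \<in> {1..n}" for j
  proof -
    have \<pi>j: "\<pi> j \<in> {1..n}" using \<pi>(1) j by (metis permutes_in_image)
    have "y j \<in> U j \<inter> U (\<pi> j)" using y[OF j] x[OF \<pi>j] \<pi>(2)[OF j] by simp
    hence "\<phi> j = \<phi> (\<pi> j)"
      using assms(1) j \<pi>j unfolding sym_chart_family_def by (metis empty_iff)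
    thus ?thesis using \<pi>(2)[OF j] by simp
  qed
  hence "elem_sym n k (\<lambda>j. \<phi> j (y j)) = elem_sym n k (\<lambda>j. \<phi> (\<pi> j) (x (\<pi> j)))"
    unfolding elem_sym_def by (intro sum.cong prod.cong) auto
  also have "\<dots> = elem_sym n k (\<lambda>j. \<phi> j (x j))"
    using elem_sym_permute[OF \<pi>(1), of k "\<lambda>j. \<phi> j (x j)"] .
  finally show ?thesis by (simp add: sym_chart_def y_def)
qed

end

theory Submission
  imports Defs
begin

text \<open>
Let \<open>x\<close>, \<open>x0\<close> be points of the disc and \<open>a\<close> an entry of \<open>f x\<close>. For every entry \<open>b\<close> of \<open>f x0\<close> let \<open>g b\<close> be a
holomorphic map from \<open>X\<close> to the disc with \<open>g b b = 0\<close>, and let \<open>G\<close> be the product of the \<open>g b\<close> over the \<open>n\<close>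
entries of \<open>f x0\<close>, counted with multiplicity. It suffices to show that \<open>norm (G a)\<close> is at most the Moebius
distance of \<open>x\<close> and \<open>x0\<close> (lemma \<open>prod_over_entries_le_Moebius\<close>): each \<open>g b\<close> may be chosen such that
\<open>norm (g b a)\<close> almost equals the Moebius distance of \<open>a\<close> and \<open>b\<close>, so the \<open>n\<close>-th power of the smallest of
these distances is bounded by the product. Exchanging \<open>x\<close> and \<open>x0\<close>, and using that Moebius distances are
symmetric, gives the other half of the Hausdorff distance.

The bound is a Schwarz lemma for the multivalued function \<open>l \<mapsto> G (entries of f l)\<close>. This function is
bounded by 1 and tends to 0 at \<open>x0\<close> like \<open>norm (l - x0)\<close>, in spite of the branching of \<open>f\<close> at \<open>x0\<close>, because
an entry of multiplicity \<open>k\<close> is a \<open>k\<close>-fold zero of \<open>G\<close> (lemma \<open>entries_product_near_zero\<close>). To pass to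
single-valued functions, consider for each \<open>N\<close> the sum of \<open>G p ^ N\<close> over the entries \<open>p\<close> of \<open>f l\<close>. It is
holomorphic in \<open>l\<close> (lemmas \<open>trace_holomorphic\<close> and \<open>holomorphic_sum_over_entries\<close>), bounded by \<open>n\<close>, and
vanishes at \<open>x0\<close> to order \<open>N\<close>, hence is at most \<open>n * m ^ N\<close> by the Schwarz lemma, where \<open>m\<close> is the modulus of
the disc automorphism with zero \<open>x0\<close> at the point \<open>l\<close>. As this holds for all \<open>N\<close>, every single value
of \<open>G\<close> is at most \<open>m\<close> (lemma \<open>norm_le_of_power_sums_le\<close>).
\<close>

section \<open>Power sums and a Schwarz lemma of higher order\<close>

text \<open>
The bound on the power sums may lose a constant factor \<open>C\<close>, since it is assumed for all exponents:
a polynomial \<open>L\<close> that vanishes at all values of \<open>w\<close> but \<open>w i\<close> singles out the contribution of \<open>w i\<close>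
to the power sums, and this contribution grows like \<open>norm (w i) ^ N\<close>.
\<close>

lemma norm_le_of_power_sums_le:
  fixes w :: "'i \<Rightarrow> complex"
  assumes fin: "finite J" and m: "m \<ge> 0"
    and le: "\<And>N. norm (\<Sum>j\<in>J. w j ^ N) \<le> C * m ^ N"
    and i: "i \<in> J"
  shows "norm (w i) \<le> m"
proof (rule ccontr)
  assume "\<not> norm (w i) \<le> m"
  hence gt: "m < norm (w i)" by simp
  define L :: "complex poly" where "L = (\<Prod>v\<in>w ` J - {w i}. [:-v, 1:])"
  define D where "D = (\<Sum>k\<le>degree L. norm (coeff L k) * C * m ^ k)"
  have Lw: "poly L (w j) = (if w j = w i then poly L (w i) else 0)" if "j \<in> J" for j
    using that fin by (auto simp: L_def poly_prod prod_zero_iff)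
  have L0: "poly L (w i) \<noteq> 0" using fin by (auto simp: L_def poly_prod)
  have bound: "norm (w i) ^ N * norm (poly L (w i)) \<le> D * m ^ N" for N
  proof -
    have "(\<Sum>j\<in>J. w j ^ N * poly L (w j)) = (\<Sum>j\<in>J. if w j = w i then w i ^ N * poly L (w i) else 0)"
      by (intro sum.cong refl) (use Lw in auto)
    also have "\<dots> = of_nat (card {j\<in>J. w j = w i}) * (w i ^ N * poly L (w i))"
      using fin by (simp add: sum.If_cases Int_def)
    finally have eq: "of_nat (card {j\<in>J. w j = w i}) * (w i ^ N * poly L (w i)) =
        (\<Sum>j\<in>J. w j ^ N * poly L (w j))" ..
    have "card {j\<in>J. w j = w i} \<noteq> 0" using i fin by auto
    hence "1 \<le> real (card {j\<in>J. w j = w i})" by linarith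
    hence "norm (w i) ^ N * norm (poly L (w i)) \<le>
        real (card {j\<in>J. w j = w i}) * (norm (w i) ^ N * norm (poly L (w i)))"
      using mult_right_mono[of 1 _ "norm (w i) ^ N * norm (poly L (w i))"] by simp
    also have "\<dots> = norm (\<Sum>j\<in>J. w j ^ N * poly L (w j))"
      unfolding eq[symmetric] by (simp add: norm_mult norm_power)
    also have "(\<Sum>j\<in>J. w j ^ N * poly L (w j)) =
        (\<Sum>k\<le>degree L. coeff L k * (\<Sum>j\<in>J. w j ^ (N + k)))"
      unfolding poly_altdef sum_distrib_left
      by (subst sum.swap) (simp add: power_add mult_ac)
    also have "norm \<dots> \<le> (\<Sum>k\<le>degree L. norm (coeff L k) * (C * m ^ (N + k)))"
      by (intro sum_norm_le) (simp add: norm_mult mult_left_mono le)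
    also have "\<dots> = D * m ^ N"
      unfolding D_def sum_distrib_right by (simp add: power_add mult_ac)
    finally show ?thesis .
  qed
  show False
  proof (cases "m = 0")
    case True
    thus ?thesis using bound[of 1] gt L0 by (simp add: mult_le_0_iff)
  next
    case False
    with m have m': "m > 0" by simp
    have "1 < norm (w i) / m" using gt m' by simp
    then obtain N where N: "D / norm (poly L (w i)) < (norm (w i) / m) ^ N"
      using real_arch_pow by blast
    thus False using bound[of N] L0 m' by (simp add: field_simps)
  qed
qed

text \<open>
The constant \<open>C\<close> only certifies a zero of order \<open>N\<close> at the origin. Induction on \<open>N\<close>: the Schwarz lemma
turns \<open>h z / z\<close> into a function with the same bound \<open>K\<close> and a zero of order one less.
\<close>

lemma Schwarz_Lemma_order:
  assumes "h holomorphic_on ball 0 1" and "\<And>z. norm z < 1 \<Longrightarrow> norm (h z) \<le> K"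
    and "e > 0" and "\<And>z. norm z < e \<Longrightarrow> norm (h z) \<le> C * norm z ^ N"
    and "norm z < 1"
  shows "norm (h z) \<le> K * norm z ^ N"
  using assms
proof (induction N arbitrary: h z e)
  case 0
  thus ?case by simp
next
  case (Suc N)
  have h0: "h 0 = 0" using Suc.prems(4)[of 0] Suc.prems(3) by simp
  obtain k where k: "k holomorphic_on ball 0 1" "\<And>z. norm z < 1 \<Longrightarrow> h z = z * k z"
      "deriv h 0 = k 0"
    using Schwarz3[OF Suc.prems(1) h0] by blast
  have K0: "K \<ge> 0" using Suc.prems(2)[of 0] h0 by simp
  have kK: "norm (k z) \<le> K" if z: "norm z < 1" for z
  proof (rule field_le_epsilon)
    \<comment> \<open>\<open>K + \<epsilon>\<close> in place of \<open>K\<close>, since the Schwarz lemma wants a strict bound.\<close>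
    fix \<epsilon> :: real assume \<epsilon>: "\<epsilon> > 0"
    define g where "g z = h z / of_real (K + \<epsilon>)" for z
    have g: "g holomorphic_on ball 0 1"
      unfolding g_def by (intro holomorphic_intros Suc.prems(1)) (use K0 \<epsilon> in \<open>auto simp flip: of_real_add\<close>)
    have [simp]: "g 0 = 0" by (simp add: g_def h0)
    have nK: "norm (of_real (K + \<epsilon>) :: complex) = K + \<epsilon>" using K0 \<epsilon> by (simp only: norm_of_real)
    have lt: "norm (g z) < 1" if "norm z < 1" for z
      unfolding g_def norm_divide nK using Suc.prems(2)[OF that] K0 \<epsilon> by (simp add: field_simps)
    show "norm (k z) \<le> K + \<epsilon>"
    proof (cases "z = 0")
      case True
      have "h field_differentiable at 0"
        using Suc.prems(1) by (simp add: holomorphic_on_imp_differentiable_at)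
      hence "deriv g 0 = k 0 / of_real (K + \<epsilon>)"
        unfolding g_def k(3)[symmetric] by (intro deriv_cdivide_right)
      moreover have "norm (deriv g 0) \<le> 1" using Schwarz_Lemma(2)[OF g _ lt, of 0] by simp
      ultimately have "norm (k 0) / (K + \<epsilon>) \<le> 1" by (simp only: norm_divide nK)
      thus ?thesis using True K0 \<epsilon> by (simp add: field_simps)
    next
      case False
      have "norm (g z) \<le> norm z" using Schwarz_Lemma(1)[OF g _ lt z] by simp
      hence "norm z * norm (k z) \<le> norm z * (K + \<epsilon>)"
        unfolding g_def norm_divide nK k(2)[OF z] norm_mult using K0 \<epsilon> by (simp add: field_simps)
      thus ?thesis using False by simp
    qed
  qed
  define d where "d = min e 1"
  have d: "d > 0" using Suc.prems(3) by (simp add: d_def)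
  have near: "norm (k z) \<le> C * norm z ^ N" if z: "norm z < d" for z
  proof -
    have nz: "norm (k z) \<le> C * norm z ^ N" if "norm z < d" "z \<noteq> 0" for z
      using Suc.prems(4)[of z] k(2)[of z] that by (simp add: d_def norm_mult)
    show ?thesis
    proof (cases "z = 0")
      case True
      have "isCont k 0" using k(1) 
        using holomorphic_on_imp_continuous_on[OF k(1)] by (simp add: continuous_on_eq_continuous_at)
      hence "((\<lambda>z. norm (k z)) \<longlongrightarrow> norm (k 0)) (at 0)" by (intro tendsto_norm) (simp add: isCont_def)
      moreover have "((\<lambda>z::complex. C * norm z ^ N) \<longlongrightarrow> C * norm (0::complex) ^ N) (at 0)"
        by (intro tendsto_intros)
      moreover have "eventually (\<lambda>z. norm (k z) \<le> C * norm z ^ N) (at 0)"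
        unfolding eventually_at using d nz by (auto intro!: exI[of _ d])
      ultimately have "norm (k 0) \<le> C * norm (0::complex) ^ N"
        using tendsto_le[OF trivial_limit_at] by blast
      thus ?thesis by (simp add: True)
    qed (use nz z in auto)
  qed
  have "norm (k z) \<le> K * norm z ^ N"
    using Suc.IH[OF k(1) kK d near Suc.prems(5)] .
  from mult_left_mono[OF this norm_ge_zero[of z]] show ?case
    using k(2)[OF Suc.prems(5)] by (simp add: norm_mult mult_ac)
qed

section \<open>Roots of polynomials with holomorphic coefficients\<close>

lemma elem_sym_0: "elem_sym n 0 z = 1"
proof -
  have "{S. S \<subseteq> {1..n} \<and> card S = 0} = {{}}"
    by (auto dest: finite_subset)
  thus ?thesis by (simp add: elem_sym_def)
qed

lemma prod_diff_eq_elem_sym: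
  "(\<Prod>j\<in>{1..n}. T - z j) = (\<Sum>k\<le>n. (-1) ^ k * elem_sym n k z * T ^ (n - k))"
proof -
  have "(\<Prod>j\<in>{1..n}. T - z j) = (\<Prod>j\<in>{1..n}. - z j + T)" by simp
  also have "\<dots> = (\<Sum>S\<in>Pow {1..n}. (\<Prod>j\<in>S. - z j) * (\<Prod>j\<in>{1..n}-S. T))"
    by (rule prod_add) simp
  also have "\<dots> = (\<Sum>k\<le>n. \<Sum>S | S \<in> Pow {1..n} \<and> card S = k. (\<Prod>j\<in>S. - z j) * (\<Prod>j\<in>{1..n}-S. T))"
    by (rule sum.group[symmetric]) (auto dest: card_mono[rotated])
  also have "\<dots> = (\<Sum>k\<le>n. (-1) ^ k * elem_sym n k z * T ^ (n - k))"
  proof (rule sum.cong[OF refl])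
    fix k
    show "(\<Sum>S | S \<in> Pow {1..n} \<and> card S = k. (\<Prod>j\<in>S. - z j) * (\<Prod>j\<in>{1..n}-S. T)) =
        (-1) ^ k * elem_sym n k z * T ^ (n - k)"
      unfolding elem_sym_def sum_distrib_left sum_distrib_right
      by (intro sum.cong) (auto simp: prod_uminus card_Diff_subset finite_subset)
  qed
  finally show ?thesis .
qed

text \<open>
Differentiation under the integral sign. Numerator and denominator share the coefficients \<open>a k\<close>, as is
the case for a polynomial with varying coefficients and its derivative.
\<close>

lemma holomorphic_contour_integral_quotient:
  fixes a :: "nat \<Rightarrow> complex \<Rightarrow> complex"
  assumes W: "open W" "convex W" and r: "r > 0"
    and a: "\<And>k. k \<in> K \<Longrightarrow> a k holomorphic_on W"
    and u: "\<And>k. k \<in> K \<Longrightarrow> continuous_on (sphere c r) (u k)"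
    and v: "\<And>k. k \<in> K \<Longrightarrow> continuous_on (sphere c r) (v k)"
    and nz: "\<And>l T. l \<in> W \<Longrightarrow> T \<in> sphere c r \<Longrightarrow> (\<Sum>k\<in>K. a k l * u k T) \<noteq> 0"
  shows "(\<lambda>l. contour_integral (circlepath c r)
            (\<lambda>T. (\<Sum>k\<in>K. a k l * v k T) / (\<Sum>k\<in>K. a k l * u k T))) holomorphic_on W"
proof -
  define \<gamma> where "\<gamma> = circlepath c r"
  define P where "P l T = (\<Sum>k\<in>K. a k l * u k T)" for l T
  define Q where "Q l T = (\<Sum>k\<in>K. a k l * v k T)" for l T
  define P' where "P' l T = (\<Sum>k\<in>K. deriv (a k) l * u k T)" for l T
  define Q' where "Q' l T = (\<Sum>k\<in>K. deriv (a k) l * v k T)" for l T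
  define d where "d t = vector_derivative \<gamma> (at t)" for t
  have \<gamma>: "\<gamma> t \<in> sphere c r" if "t \<in> {0..1}" for t
    using that r path_image_circlepath[of c r] unfolding \<gamma>_def path_image_def
    by (metis abs_of_pos imageI)
  have c\<gamma>: "continuous_on {0..1} \<gamma>"
    unfolding \<gamma>_def by (simp flip: path_def)
  have cd: "continuous_on {0..1} d"
    unfolding d_def \<gamma>_def vector_derivative_circlepath by (intro continuous_intros)
  have cg: "continuous_on (W \<times> {0..1}) (\<lambda>(l,t). g (\<gamma> t))" if "continuous_on (sphere c r) g" for g :: "complex \<Rightarrow> complex"
    unfolding case_prod_unfold
    by (rule continuous_on_compose2[OF that]) (use \<gamma> in \<open>auto intro!: continuous_on_compose2[OF c\<gamma>] continuous_intros\<close>)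
  have ch: "continuous_on (W \<times> {0..1::real}) (\<lambda>(l,t). g l)" if "g holomorphic_on W" for g :: "complex \<Rightarrow> complex"
    unfolding case_prod_unfold
    by (rule continuous_on_compose2[OF holomorphic_on_imp_continuous_on[OF that]]) (auto intro!: continuous_intros)
  have cu: "continuous_on (W \<times> {0..1}) (\<lambda>x. u k (\<gamma> (snd x)))" "continuous_on (W \<times> {0..1}) (\<lambda>x. v k (\<gamma> (snd x)))"
     "continuous_on (W \<times> {0..1::real}) (\<lambda>x. a k (fst x))"
     "continuous_on (W \<times> {0..1::real}) (\<lambda>x. deriv (a k) (fst x))"
    if "k \<in> K" for k
    using cg[OF u[OF that]] cg[OF v[OF that]] ch[OF a[OF that]] ch[OF holomorphic_deriv[OF a[OF that] W(1)]]
    by (simp_all add: case_prod_unfold)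
  have cd2: "continuous_on (W \<times> {0..1}) (\<lambda>x. d (snd x))"
    by (rule continuous_on_compose2[OF cd]) (auto intro!: continuous_intros)
  have nz': "P l (\<gamma> t) \<noteq> 0" if "l \<in> W" "t \<in> {0..1}" for l t
    using nz[OF that(1) \<gamma>[OF that(2)]] by (simp add: P_def)
  have "(\<lambda>l. integral (cbox 0 1) (\<lambda>t. Q l (\<gamma> t) / P l (\<gamma> t) * d t)) holomorphic_on W"
  proof (rule leibniz_rule_holomorphic[where
      fx = "\<lambda>l t. (Q' l (\<gamma> t) * P l (\<gamma> t) - Q l (\<gamma> t) * P' l (\<gamma> t)) / (P l (\<gamma> t) * P l (\<gamma> t)) * d t"])
    fix l and t :: real assume l: "l \<in> W" and t: "t \<in> cbox 0 1"
    have a': "(a k has_field_derivative deriv (a k) l) (at l within W)" if "k \<in> K" for k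
      using holomorphic_derivI[OF a[OF that] W(1) l] by (rule has_field_derivative_at_within)
    have "((\<lambda>l. P l (\<gamma> t)) has_field_derivative P' l (\<gamma> t)) (at l within W)"
         "((\<lambda>l. Q l (\<gamma> t)) has_field_derivative Q' l (\<gamma> t)) (at l within W)"
      unfolding P_def P'_def Q_def Q'_def
      by (auto intro!: DERIV_sum DERIV_cmult_right a')
    thus "((\<lambda>l. Q l (\<gamma> t) / P l (\<gamma> t) * d t) has_field_derivative
        (Q' l (\<gamma> t) * P l (\<gamma> t) - Q l (\<gamma> t) * P' l (\<gamma> t)) / (P l (\<gamma> t) * P l (\<gamma> t)) * d t) (at l within W)"
      using nz'[OF l, of t] t by (intro DERIV_cmult_right DERIV_divide) auto
  next
    fix l assume l: "l \<in> W"
    show "(\<lambda>t. Q l (\<gamma> t) / P l (\<gamma> t) * d t) integrable_on cbox 0 1"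
      unfolding P_def Q_def
      by (intro integrable_continuous continuous_intros continuous_on_compose2[OF u _ ] continuous_on_compose2[OF v _ ])
        (use l \<gamma> c\<gamma> cd nz' in \<open>auto simp: P_def\<close>)
  next
    show "continuous_on (W \<times> cbox 0 1) (\<lambda>(l, t). (Q' l (\<gamma> t) * P l (\<gamma> t) - Q l (\<gamma> t) * P' l (\<gamma> t)) / (P l (\<gamma> t) * P l (\<gamma> t)) * d t)"
      unfolding case_prod_unfold
      using nz' unfolding P_def Q_def P'_def Q'_def
      by (auto intro!: continuous_intros cu cd2)
  qed (rule W)
  thus ?thesis
    unfolding contour_integral_integral P_def Q_def d_def \<gamma>_def by simp
qed

text \<open>
The \<open>z l j\<close> need not depend continuously on \<open>l\<close>; only their symmetric functions are holomorphic. With the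
monic polynomial \<open>P l\<close> whose roots are the \<open>z l j\<close>, the sum of the \<open>\<psi> (z l j)\<close> is, by Cauchy's formula, the sum
over the distinct centres \<open>C0\<close> of \<open>1 / (2 \<pi> \<i>)\<close> times the integrals over the unit circle around \<open>C0\<close> of
\<open>\<psi> T * (P l)' T / P l T\<close>, in which \<open>l\<close> enters only through the elementary symmetric functions.
\<close>

lemma trace_holomorphic:
  fixes z :: "complex \<Rightarrow> nat \<Rightarrow> complex" and c :: "nat \<Rightarrow> complex"
  assumes W: "open W" "convex W"
    and e: "\<And>k. k \<in> {1..n} \<Longrightarrow> (\<lambda>l. elem_sym n k (z l)) holomorphic_on W"
    and z: "\<And>l j. l \<in> W \<Longrightarrow> j \<in> {1..n} \<Longrightarrow> z l j \<in> ball (c j) 1"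
    and far: "\<And>i j. i \<in> {1..n} \<Longrightarrow> j \<in> {1..n} \<Longrightarrow> c i \<noteq> c j \<Longrightarrow> dist (c i) (c j) \<ge> 4"
    and \<psi>: "\<psi> holomorphic_on (\<Union>j\<in>{1..n}. ball (c j) 2)"
  shows "(\<lambda>l. \<Sum>j\<in>{1..n}. \<psi> (z l j)) holomorphic_on W"
proof -
  define a where "a k l = (-1) ^ k * elem_sym n k (z l)" for k l
  have a: "a k holomorphic_on W" if "k \<in> {..n}" for k
  proof (cases "k = 0")
    case False
    with that show ?thesis unfolding a_def by (intro holomorphic_intros e) auto
  qed (simp add: a_def[abs_def] elem_sym_0)
  define P where "P l T = (\<Sum>k\<le>n. a k l * T ^ (n - k))" for l T
  \<comment> \<open>\<open>Q l\<close> is the derivative of the polynomial \<open>P l\<close>.\<close>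
  define Q where "Q l T = (\<Sum>k\<le>n. a k l * (of_nat (n - k) * T ^ (n - k - 1)))" for l T
  have P: "P l = (\<lambda>T. \<Prod>j\<in>{1..n}. T - z l j)" for l
    unfolding P_def a_def by (rule ext) (rule prod_diff_eq_elem_sym[symmetric])
  have PQ: "Q l T / P l T = (\<Sum>j\<in>{1..n}. 1 / (T - z l j))"
    if "\<And>j. j \<in> {1..n} \<Longrightarrow> T \<noteq> z l j" for l T
  proof -
    have "((\<lambda>T. \<Prod>j\<in>{1..n}. T - z l j) has_field_derivative
        (\<Prod>j\<in>{1..n}. T - z l j) * (\<Sum>j\<in>{1..n}. 1 / (T - z l j))) (at T)"
      by (rule has_field_derivative_prod') (use that in \<open>auto intro!: derivative_eq_intros\<close>)
    hence 1: "(P l has_field_derivative P l T * (\<Sum>j\<in>{1..n}. 1 / (T - z l j))) (at T)"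
      unfolding P .
    have 2: "(P l has_field_derivative Q l T) (at T)"
      unfolding P_def Q_def by (auto intro!: derivative_eq_intros sum.cong)
    have "Q l T = P l T * (\<Sum>j\<in>{1..n}. 1 / (T - z l j))"
      using DERIV_unique[OF 2 1] .
    moreover have "P l T \<noteq> 0" unfolding P using that by (auto simp: prod_zero_iff)
    ultimately show ?thesis by simp
  qed
  define C where "C = c ` {1..n}"
  have off: "T \<noteq> z l j" if l: "l \<in> W" and j: "j \<in> {1..n}" and C0: "C0 \<in> C" and S: "T \<in> sphere C0 1" for l j C0 T
  proof
    assume T: "T = z l j"
    obtain i where i: "i \<in> {1..n}" "C0 = c i" using C0 by (auto simp: C_def)
    have "dist (c j) T < 1" using z[OF l j] T by simp
    moreover have "dist (c i) T = 1" using S i by simp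
    ultimately show False
      using far[OF i(1) j] dist_triangle[of "c i" "c j" T] dist_commute[of T "c j"] by force
  qed
  have \<psi>b: "\<psi> holomorphic_on ball C0 2" if "C0 \<in> C" for C0
    using \<psi> by (rule holomorphic_on_subset) (use that in \<open>auto simp: C_def\<close>)
  define I where "I C0 l = contour_integral (circlepath C0 1) (\<lambda>T. \<psi> T * Q l T / P l T)" for C0 l
  have I_hol: "I C0 holomorphic_on W" if C0: "C0 \<in> C" for C0
  proof -
    have "continuous_on (sphere C0 1) \<psi>"
      by (rule holomorphic_on_imp_continuous_on, rule holomorphic_on_subset[OF \<psi>b[OF C0]]) auto
    moreover have "P l T \<noteq> 0" if "l \<in> W" "T \<in> sphere C0 1" for l T
      unfolding P using off[OF that(1) _ C0 that(2)] by (auto simp: prod_zero_iff)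
    ultimately have "(\<lambda>l. contour_integral (circlepath C0 1)
        (\<lambda>T. (\<Sum>k\<in>{..n}. a k l * (\<psi> T * (of_nat (n - k) * T ^ (n - k - 1)))) /
             (\<Sum>k\<in>{..n}. a k l * T ^ (n - k)))) holomorphic_on W"
      by (intro holomorphic_contour_integral_quotient W a continuous_intros) (auto simp: P_def)
    moreover have "(\<Sum>k\<in>{..n}. a k l * (\<psi> T * (of_nat (n - k) * T ^ (n - k - 1)))) = \<psi> T * Q l T" for l T
      unfolding Q_def sum_distrib_left by (simp add: mult_ac)
    ultimately show ?thesis unfolding I_def[abs_def] by (simp only: P_def)
  qed
  have one: "((\<lambda>T. \<psi> T / (T - z l j)) has_contour_integral
      (if C0 = c j then 2 * of_real pi * \<i> * \<psi> (z l j) else 0)) (circlepath C0 1)"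
    if l: "l \<in> W" and j: "j \<in> {1..n}" and C0: "C0 \<in> C" for l j C0
  proof (cases "C0 = c j")
    case True
    have "\<psi> holomorphic_on cball (c j) 1"
      using True by (intro holomorphic_on_subset[OF \<psi>b[OF C0]]) auto
    moreover have "norm (z l j - c j) < 1"
      using z[OF l j] by (simp add: dist_norm norm_minus_commute)
    ultimately show ?thesis using True by (simp add: Cauchy_integral_circlepath_simple)
  next
    case False
    obtain i where i: "i \<in> {1..n}" "C0 = c i" using C0 by (auto simp: C_def)
    have "z l j \<notin> ball C0 2"
      using far[OF i(1) j] z[OF l j] False i(2) dist_triangle[of C0 "c j" "z l j"]
        dist_commute[of "z l j" "c j"] by auto
    hence "(\<lambda>T. \<psi> T / (T - z l j)) holomorphic_on ball C0 2"
      by (intro holomorphic_intros \<psi>b C0) auto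
    hence "((\<lambda>T. \<psi> T / (T - z l j)) has_contour_integral 0) (circlepath C0 1)"
      by (rule Cauchy_theorem_disc_simple) auto
    thus ?thesis using False by simp
  qed
  have I_eq: "I C0 l = (\<Sum>j\<in>{1..n}. if C0 = c j then 2 * of_real pi * \<i> * \<psi> (z l j) else 0)"
    if l: "l \<in> W" and C0: "C0 \<in> C" for l C0
  proof -
    have "I C0 l = contour_integral (circlepath C0 1) (\<lambda>T. \<Sum>j\<in>{1..n}. \<psi> T / (T - z l j))"
      unfolding I_def
    proof (rule contour_integral_cong[OF refl])
      fix T assume "T \<in> path_image (circlepath C0 1)"
      hence "Q l T / P l T = (\<Sum>j\<in>{1..n}. 1 / (T - z l j))"
        using off[OF l _ C0] by (intro PQ) auto
      hence "\<psi> T * (Q l T / P l T) = (\<Sum>j\<in>{1..n}. \<psi> T * (1 / (T - z l j)))"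
        by (simp only: sum_distrib_left)
      thus "\<psi> T * Q l T / P l T = (\<Sum>j\<in>{1..n}. \<psi> T / (T - z l j))" by simp
    qed
    also have "\<dots> = (\<Sum>j\<in>{1..n}. if C0 = c j then 2 * of_real pi * \<i> * \<psi> (z l j) else 0)"
      by (intro contour_integral_unique has_contour_integral_sum one l C0) auto
    finally show ?thesis .
  qed
  have eq: "(\<Sum>j\<in>{1..n}. \<psi> (z l j)) = (\<Sum>C0\<in>C. I C0 l) / (2 * of_real pi * \<i>)" if l: "l \<in> W" for l
  proof -
    have "(\<Sum>C0\<in>C. I C0 l) = (\<Sum>j\<in>{1..n}. \<Sum>C0\<in>C. if C0 = c j then 2 * of_real pi * \<i> * \<psi> (z l j) else 0)"
      by (subst sum.swap) (simp add: I_eq[OF l])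
    also have "\<dots> = (\<Sum>j\<in>{1..n}. 2 * of_real pi * \<i> * \<psi> (z l j))"
      by (intro sum.cong) (auto simp: C_def)
    also have "\<dots> = 2 * of_real pi * \<i> * (\<Sum>j\<in>{1..n}. \<psi> (z l j))"
      by (simp only: sum_distrib_left)
    finally show ?thesis by simp
  qed
  have "(\<lambda>l. (\<Sum>C0\<in>C. I C0 l) / (2 * of_real pi * \<i>)) holomorphic_on W"
    by (intro holomorphic_intros I_hol) auto
  thus ?thesis by (rule holomorphic_transform) (use eq in auto)
qed

text \<open>
The left-hand side is the modulus, at a root of the polynomial with parameter \<open>l\<close>, of the polynomial with
parameter \<open>l0\<close>. It is therefore bounded by the difference of the coefficients of the two polynomials,
and these are Lipschitz at \<open>l0\<close>. A single factor can only be bounded by a multiple of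
\<open>norm (l - l0)\<close> to the power \<open>1 / n\<close>.
\<close>

lemma prod_diff_le_of_elem_sym:
  fixes z :: "complex \<Rightarrow> nat \<Rightarrow> complex" and c :: "nat \<Rightarrow> complex"
  assumes W: "open W" "l0 \<in> W"
    and e: "\<And>k. k \<in> {1..n} \<Longrightarrow> (\<lambda>l. elem_sym n k (z l)) holomorphic_on W"
    and z: "\<And>l j. l \<in> W \<Longrightarrow> j \<in> {1..n} \<Longrightarrow> norm (z l j) \<le> R"
    and c: "\<And>j. j \<in> {1..n} \<Longrightarrow> z l0 j = c j"
  obtains C d where "d > 0" "ball l0 d \<subseteq> W" "C \<ge> 0"
    "\<And>l j. l \<in> ball l0 d \<Longrightarrow> j \<in> {1..n} \<Longrightarrow> (\<Prod>i\<in>{1..n}. norm (z l j - c i)) \<le> C * norm (l - l0)"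
proof -
  have ex: "\<exists>B d. B \<ge> 0 \<and> d > 0 \<and> (\<forall>l\<in>ball l0 d. norm (elem_sym n k (z l) - elem_sym n k (z l0)) \<le> B * norm (l - l0))"
    if k: "k \<le> n" for k
  proof (cases "k = 0")
    case True
    hence "(0::real) \<ge> 0 \<and> (1::real) > 0 \<and> (\<forall>l\<in>ball l0 1. norm (elem_sym n k (z l) -
        elem_sym n k (z l0)) \<le> 0 * norm (l - l0))"
      by (simp add: elem_sym_0)
    thus ?thesis by blast
  next
    case False
    define g where "g l = elem_sym n k (z l)" for l
    have "(g has_field_derivative deriv g l0) (at l0)"
      unfolding g_def using False k by (intro holomorphic_derivI[OF e W]) auto
    hence "((\<lambda>l. (g l - g l0) / (l - l0)) \<longlongrightarrow> deriv g l0) (at l0)"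
      by (simp add: has_field_derivative_iff)
    hence "eventually (\<lambda>l. dist ((g l - g l0) / (l - l0)) (deriv g l0) < 1) (at l0)"
      by (rule tendstoD) simp
    then obtain d where d: "d > 0" "\<And>l. l \<noteq> l0 \<Longrightarrow> dist l l0 < d \<Longrightarrow> dist ((g l - g l0) / (l - l0)) (deriv g l0) < 1"
      unfolding eventually_at by auto
    have "norm (g l - g l0) \<le> (norm (deriv g l0) + 1) * norm (l - l0)" if "l \<in> ball l0 d" for l
    proof (cases "l = l0")
      case False
      have "norm ((g l - g l0) / (l - l0)) \<le> norm (deriv g l0) + 1"
        using d(2)[OF False] that norm_triangle_sub[of "(g l - g l0) / (l - l0)" "deriv g l0"]
        by (simp add: dist_norm norm_minus_commute)
      thus ?thesis using False by (simp add: norm_divide field_simps)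
    qed simp
    hence "norm (deriv g l0) + 1 \<ge> 0 \<and> d > 0 \<and> (\<forall>l\<in>ball l0 d. norm (elem_sym n k (z l) -
        elem_sym n k (z l0)) \<le> (norm (deriv g l0) + 1) * norm (l - l0))"
      using d(1) unfolding g_def by auto
    thus ?thesis by blast
  qed
  then obtain B d where B: "\<And>k. k \<le> n \<Longrightarrow> B k \<ge> 0" and d: "\<And>k. k \<le> n \<Longrightarrow> d k > 0"
    and Bd: "\<And>k l. k \<le> n \<Longrightarrow> l \<in> ball l0 (d k) \<Longrightarrow>
        norm (elem_sym n k (z l) - elem_sym n k (z l0)) \<le> B k * norm (l - l0)"
    by metis
  obtain d' where d': "d' > 0" "ball l0 d' \<subseteq> W" using W open_contains_ball by blast
  define \<delta> where "\<delta> = min d' (Min (d ` {..n}))"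
  have \<delta>: "\<delta> > 0" "ball l0 \<delta> \<subseteq> W" using d d' by (auto simp: \<delta>_def)
  have \<delta>d: "l \<in> ball l0 (d k)" if "l \<in> ball l0 \<delta>" "k \<le> n" for l k
    using that by (auto simp: \<delta>_def)
  define C where "C = (\<Sum>k\<le>n. B k * \<bar>R\<bar> ^ (n - k))"
  have "C \<ge> 0" unfolding C_def using B by (intro sum_nonneg) auto
  moreover have "(\<Prod>i\<in>{1..n}. norm (z l j - c i)) \<le> C * norm (l - l0)"
    if l: "l \<in> ball l0 \<delta>" and j: "j \<in> {1..n}" for l j
  proof -
    have lW: "l \<in> W" using l \<delta> by auto
    have 0: "(\<Prod>i\<in>{1..n}. z l j - z l i) = 0" using j by (auto simp: prod_zero_iff)
    have "(\<Prod>i\<in>{1..n}. norm (z l j - c i)) = norm (\<Prod>i\<in>{1..n}. z l j - z l0 i)"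
      unfolding prod_norm[symmetric] using c by (intro prod.cong) auto
    also have "\<dots> = norm ((\<Prod>i\<in>{1..n}. z l j - z l i) - (\<Prod>i\<in>{1..n}. z l j - z l0 i))"
      unfolding 0 by simp
    also have "\<dots> = norm (\<Sum>k\<le>n. (-1) ^ k * (elem_sym n k (z l) - elem_sym n k (z l0)) * z l j ^ (n - k))"
      unfolding prod_diff_eq_elem_sym sum_subtractf[symmetric] by (simp add: algebra_simps)
    also have "\<dots> \<le> (\<Sum>k\<le>n. B k * norm (l - l0) * \<bar>R\<bar> ^ (n - k))"
    proof (rule sum_norm_le)
      fix k assume k: "k \<in> {..n}"
      have "norm (z l j) \<le> \<bar>R\<bar>" using z[OF lW j] by simp
      thus "norm ((-1) ^ k * (elem_sym n k (z l) - elem_sym n k (z l0)) * z l j ^ (n - k))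
          \<le> B k * norm (l - l0) * \<bar>R\<bar> ^ (n - k)"
        unfolding norm_mult norm_power using k Bd[OF _ \<delta>d[OF l], of k] B[of k]
        by (auto intro!: mult_mono power_mono)
    qed
    also have "\<dots> = C * norm (l - l0)"
      unfolding C_def sum_distrib_right by (simp add: mult_ac)
    finally show ?thesis .
  qed
  ultimately show ?thesis using that \<delta> by blast
qed

section \<open>Holomorphic functions and charts on Riemann surfaces\<close>

definition holomorphic_function :: "'a surface \<Rightarrow> ('a \<Rightarrow> complex) \<Rightarrow> bool" where
  "holomorphic_function X g \<longleftrightarrow> (\<forall>(U, \<phi>)\<in>atlas X. (g \<circ> inv_into U \<phi>) holomorphic_on \<phi> ` U)"

lemma inv_into_identity: "z \<in> S \<Longrightarrow> inv_into S (\<lambda>z. z) z = z"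
  by (intro inv_into_f_f) (auto simp: inj_on_def)

lemma chart_inj: "is_chart T U \<phi> \<Longrightarrow> inj_on \<phi> U"
  unfolding is_chart_def
  by (metis homeomorphic_imp_injective_map inf.absorb2 openin_subset topspace_subtopology)

lemma chart_subset: "is_chart T U \<phi> \<Longrightarrow> U \<subseteq> topspace T"
  unfolding is_chart_def by (simp add: openin_subset)

lemma riemann_surface_charts:
  assumes "riemann_surface X" "(U, \<phi>) \<in> atlas X"
  shows "is_chart (topol X) U \<phi>"
  using assms unfolding riemann_surface_def by blast

lemma riemann_surface_compatible:
  assumes "riemann_surface X" "(U, \<phi>) \<in> atlas X" "(V, \<psi>) \<in> atlas X"
  shows "compatible U \<phi> V \<psi>"
  using assms unfolding riemann_surface_def by fast

lemma holomorphic_maps_disc_iff: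
  assumes X: "riemann_surface X"
  shows "g \<in> holomorphic_maps X disc \<longleftrightarrow>
    continuous_map (topol X) (top_of_set (ball 0 1)) g \<and> holomorphic_function X g"
proof -
  have "(\<forall>(U, \<phi>)\<in>atlas X. (((\<lambda>w. w) \<circ> (\<lambda>z. z) \<circ> g \<circ> inv_into U \<phi>) holomorphic_on \<phi> ` {x \<in> U. g x \<in> ball 0 1}))
     \<longleftrightarrow> holomorphic_function X g"
    if g: "continuous_map (topol X) (top_of_set (ball 0 1)) g"
    unfolding holomorphic_function_def
  proof (intro ball_cong refl, clarify)
    fix U \<phi> assume U: "(U, \<phi>) \<in> atlas X"
    have "g x \<in> ball 0 1" if "x \<in> U" for x
      using chart_subset[OF riemann_surface_charts[OF X U]] g that
      by (auto simp: continuous_map_def)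
    hence "{x \<in> U. g x \<in> ball 0 1} = U" by blast
    thus "((\<lambda>w. w) \<circ> (\<lambda>z. z) \<circ> g \<circ> inv_into U \<phi> holomorphic_on \<phi> ` {x \<in> U. g x \<in> ball 0 1}) \<longleftrightarrow>
        (g \<circ> inv_into U \<phi> holomorphic_on \<phi> ` U)"
      by (simp add: o_def)
  qed
  thus ?thesis
    unfolding holomorphic_maps_def holomorphic_maps_wrt_def disc_def
    by (simp only: mem_Collect_eq charted.simps ball_simps prod.case) blast
qed

lemma holomorphic_maps_disc_norm_less:
  assumes "g \<in> holomorphic_maps X disc" "x \<in> topspace (topol X)"
  shows "norm (g x) < 1"
  using assms by (auto simp: holomorphic_maps_def holomorphic_maps_wrt_def disc_def continuous_map_def)

lemma holomorphic_maps_disc_compose: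
  assumes X: "riemann_surface X" and g: "g \<in> holomorphic_maps X disc"
    and m: "m holomorphic_on ball 0 1" "\<And>z. norm z < 1 \<Longrightarrow> norm (m z) < 1"
  shows "m \<circ> g \<in> holomorphic_maps X disc"
proof -
  have gc: "continuous_map (topol X) (top_of_set (ball 0 1)) g" and gh: "holomorphic_function X g"
    using g holomorphic_maps_disc_iff[OF X] by auto
  have "continuous_map (top_of_set (ball 0 1)) (top_of_set (ball 0 1)) m"
    using m by (auto intro!: holomorphic_on_imp_continuous_on)
  hence "continuous_map (topol X) (top_of_set (ball 0 1)) (m \<circ> g)"
    using gc continuous_map_compose by blast
  moreover have "holomorphic_function X (m \<circ> g)"
    unfolding holomorphic_function_def
  proof clarify
    fix U \<phi> assume U: "(U, \<phi>) \<in> atlas X"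
    have "(g \<circ> inv_into U \<phi>) ` \<phi> ` U \<subseteq> ball 0 1"
    proof clarify
      fix x assume "x \<in> U"
      have c: "is_chart (topol X) U \<phi>" by (rule riemann_surface_charts[OF X U])
      have "(g \<circ> inv_into U \<phi>) (\<phi> x) = g x" using \<open>x \<in> U\<close> chart_inj[OF c] by simp
      thus "(g \<circ> inv_into U \<phi>) (\<phi> x) \<in> ball 0 1"
        using holomorphic_maps_disc_norm_less[OF g] chart_subset[OF c] \<open>x \<in> U\<close> by (auto simp del: o_apply)
    qed
    moreover have "(g \<circ> inv_into U \<phi>) holomorphic_on \<phi> ` U"
      using gh U by (auto simp: holomorphic_function_def)
    ultimately have "(m \<circ> (g \<circ> inv_into U \<phi>)) holomorphic_on \<phi> ` U"
      using m(1) by (meson holomorphic_on_compose_gen)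
    thus "(m \<circ> g \<circ> inv_into U \<phi>) holomorphic_on \<phi> ` U" by (simp add: o_assoc)
  qed
  ultimately show ?thesis using holomorphic_maps_disc_iff[OF X] by auto
qed

text \<open>
The preimage in the product is the union over all permutations of the correspondingly permuted boxes.
\<close>

lemma openin_sym_nbhd:
  assumes U: "\<And>j. j \<in> {1..n} \<Longrightarrow> openin T (U j)"
  shows "openin (sym_topology n T) (sym_nbhd n U)"
proof -
  have sub: "U j \<subseteq> topspace T" if "j \<in> {1..n}" for j
    using openin_subset[OF U[OF that]] .
  have "sym_nbhd n U \<subseteq> sym_points n (topspace T)"
    using sub by (fastforce simp: sym_nbhd_def sym_points_def sym_proj_def)
  moreover have "{x \<in> topspace (power_topology n T). sym_proj n x \<in> sym_nbhd n U} =
      (\<Union>\<pi>\<in>{\<pi>. \<pi> permutes {1..n}}. PiE {1..n} (\<lambda>j. U (\<pi> j)))"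
  proof (intro equalityI subsetI)
    fix x assume "x \<in> {x \<in> topspace (power_topology n T). sym_proj n x \<in> sym_nbhd n U}"
    then obtain y where x: "x \<in> PiE {1..n} (\<lambda>_. topspace T)"
      and y: "\<And>j. j \<in> {1..n} \<Longrightarrow> y j \<in> U j" and "sym_proj n x = sym_proj n y"
      unfolding power_topology_def sym_nbhd_def topspace_product_topology by blast
    then obtain \<pi> where \<pi>: "\<pi> permutes {1..n}" "\<And>j. j \<in> {1..n} \<Longrightarrow> x j = y (\<pi> j)"
      unfolding sym_proj_eq_iff by blast
    hence "x \<in> PiE {1..n} (\<lambda>j. U (\<pi> j))"
      using x y permutes_in_image[OF \<pi>(1)] by (auto simp: PiE_iff)
    thus "x \<in> (\<Union>\<pi>\<in>{\<pi>. \<pi> permutes {1..n}}. PiE {1..n} (\<lambda>j. U (\<pi> j)))" using \<pi>(1) by blast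
  next
    fix x assume "x \<in> (\<Union>\<pi>\<in>{\<pi>. \<pi> permutes {1..n}}. PiE {1..n} (\<lambda>j. U (\<pi> j)))"
    then obtain \<pi> where \<pi>: "\<pi> permutes {1..n}" and x: "x \<in> PiE {1..n} (\<lambda>j. U (\<pi> j))" by blast
    define y where "y = x \<circ> inv \<pi>"
    have \<pi>': "inv \<pi> permutes {1..n}" using \<pi> by (rule permutes_inv)
    have "y j \<in> U j" if "j \<in> {1..n}" for j
      using x that permutes_in_image[OF \<pi>', of j] permutes_inverses(1)[OF \<pi>, of j]
      unfolding y_def o_def by (metis PiE_mem)
    moreover have "sym_proj n x = sym_proj n y"
      unfolding sym_proj_eq_iff y_def using \<pi> by (intro exI[of _ \<pi>]) (simp add: permutes_inverses)
    moreover have "x \<in> topspace (power_topology n T)"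
    proof -
      have "x j \<in> topspace T" if j: "j \<in> {1..n}" for j
        using PiE_mem[OF x j] sub[of "\<pi> j"] permutes_in_image[OF \<pi>, of j] j by blast
      moreover have "x \<in> extensional {1..n}" using x unfolding PiE_def by blast
      ultimately show ?thesis unfolding power_topology_def topspace_product_topology PiE_def by blast
    qed
    ultimately show "x \<in> {x \<in> topspace (power_topology n T). sym_proj n x \<in> sym_nbhd n U}"
      by (auto simp: sym_nbhd_def)
  qed
  moreover have "openin (power_topology n T) (PiE {1..n} (\<lambda>j. U (\<pi> j)))" if "\<pi> permutes {1..n}" for \<pi>
  proof -
    have "openin T (U (\<pi> j))" if "j \<in> {1..n}" for j
      using U[of "\<pi> j"] permutes_in_image[OF \<open>\<pi> permutes {1..n}\<close>, of j] that by blast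
    thus ?thesis unfolding power_topology_def by (simp add: openin_PiE)
  qed
  ultimately show ?thesis
    unfolding openin_sym_topology by (auto intro!: openin_Union)
qed

lemma Hausdorff_space_separate_finite:
  assumes T: "Hausdorff_space T" and B: "finite B" "B \<subseteq> topspace T"
  obtains N where "\<And>b. b \<in> B \<Longrightarrow> openin T (N b) \<and> b \<in> N b"
    "\<And>b b'. b \<in> B \<Longrightarrow> b' \<in> B \<Longrightarrow> b \<noteq> b' \<Longrightarrow> N b \<inter> N b' = {}"
proof -
  have "\<exists>U V. openin T U \<and> openin T V \<and> a \<in> U \<and> b \<in> V \<and> U \<inter> V = {}"
    if "a \<in> B" "b \<in> B" "a \<noteq> b" for a b
    using T that B unfolding Hausdorff_space_def disjnt_def by (meson subset_iff)
  then obtain U V where UV: "\<And>a b. a \<in> B \<Longrightarrow> b \<in> B \<Longrightarrow> a \<noteq> b \<Longrightarrow>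
      openin T (U a b) \<and> openin T (V a b) \<and> a \<in> U a b \<and> b \<in> V a b \<and> U a b \<inter> V a b = {}"
    by metis
  define N where "N b = topspace T \<inter> \<Inter>((\<lambda>a. U b a \<inter> V a b) ` (B - {b}))" for b
  show ?thesis
  proof
    fix b assume b: "b \<in> B"
    have "openin T (N b)"
      unfolding N_def
    proof (cases "B - {b} = {}")
      case False
      hence "openin T (\<Inter>((\<lambda>a. U b a \<inter> V a b) ` (B - {b})))"
        using B b UV by (intro openin_Inter) auto
      thus "openin T (topspace T \<inter> \<Inter>((\<lambda>a. U b a \<inter> V a b) ` (B - {b})))" by blast
    next
      case True
      thus "openin T (topspace T \<inter> \<Inter>((\<lambda>a. U b a \<inter> V a b) ` (B - {b})))"
        by (simp only: True image_empty Inter_empty Int_UNIV_right openin_topspace)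
    qed
    thus "openin T (N b) \<and> b \<in> N b" using b UV B by (auto simp: N_def)
  next
    fix b b' assume "b \<in> B" "b' \<in> B" "b \<noteq> b'"
    thus "N b \<inter> N b' = {}" using UV[of b b'] unfolding N_def by blast
  qed
qed

text \<open>
Restrict a chart around \<open>b\<close> to a small disc and rescale it, so that its inverse \<open>\<sigma>\<close> extends to the disc with
twice the radius. The freedom in \<open>c\<close> makes it possible to give charts at different points disjoint images.
\<close>

lemma adapted_chart:
  fixes c :: complex
  assumes X: "riemann_surface X" and b: "b \<in> N" and N: "openin (topol X) N"
  obtains V \<xi> \<sigma> where "holomorphic_chart X V \<xi>" "b \<in> V" "V \<subseteq> N" "\<xi> b = c" "\<xi> ` V = ball c 1"
    "\<And>x. x \<in> V \<Longrightarrow> \<sigma> (\<xi> x) = x" "\<sigma> ` ball c 2 \<subseteq> topspace (topol X)"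
    "\<And>g. holomorphic_function X g \<Longrightarrow> (g \<circ> \<sigma>) holomorphic_on ball c 2"
proof -
  have "b \<in> topspace (topol X)" using b N openin_subset by blast
  then obtain U \<phi> where U: "(U, \<phi>) \<in> atlas X" and bU: "b \<in> U"
    using X unfolding riemann_surface_def by blast
  have ch: "is_chart (topol X) U \<phi>" by (rule riemann_surface_charts[OF X U])
  have inj: "inj_on \<phi> U" by (rule chart_inj[OF ch])
  have UT: "U \<subseteq> topspace (topol X)" by (rule chart_subset[OF ch])
  have oU: "openin (topol X) U" and o\<phi>: "open (\<phi> ` U)"
    and hom: "homeomorphic_map (subtopology (topol X) U) (top_of_set (\<phi> ` U)) \<phi>"
    using ch by (auto simp: is_chart_def)
  have "openin (subtopology (topol X) U) (U \<inter> N)"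
    using N by (simp add: openin_subtopology_Int2)
  hence "openin (top_of_set (\<phi> ` U)) (\<phi> ` (U \<inter> N))"
    using homeomorphic_map_openness[OF hom, of "U \<inter> N"] UT by auto
  hence "open (\<phi> ` (U \<inter> N))" using o\<phi> openin_open_trans by blast
  moreover have "\<phi> b \<in> \<phi> ` (U \<inter> N)" using b bU by blast
  ultimately obtain r where r: "r > 0" "ball (\<phi> b) r \<subseteq> \<phi> ` (U \<inter> N)"
    unfolding open_contains_ball by blast
  \<comment> \<open>The affine map that takes \<open>ball (\<phi> b) r\<close> to \<open>ball c 2\<close>, and its inverse.\<close>
  define \<alpha> where "\<alpha> w = c + of_real (2 / r) * (w - \<phi> b)" for w
  define \<beta> where "\<beta> t = \<phi> b + of_real (r / 2) * (t - c)" for t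
  have [simp]: "complex_of_real (2 / r) * (complex_of_real (r / 2) * u) = u"
    "complex_of_real (r / 2) * (complex_of_real (2 / r) * u) = u" for u
    using r(1) by (simp_all only: mult.assoc[symmetric] of_real_mult[symmetric]) simp_all
  have \<alpha>\<beta> [simp]: "\<alpha> (\<beta> t) = t" "\<beta> (\<alpha> w) = w" for t w
    unfolding \<alpha>_def \<beta>_def add_diff_cancel_left' by (simp_all del: of_real_divide)
  have \<alpha>_hol: "\<alpha> holomorphic_on S" and \<beta>_hol: "\<beta> holomorphic_on S" for S
    unfolding \<alpha>_def \<beta>_def by (intro holomorphic_intros)+
  have \<beta>_ball: "\<beta> t \<in> ball (\<phi> b) r" if "t \<in> ball c 2" for t
    
  proof -
    have "dist (\<phi> b) (\<beta> t) = r / 2 * dist c t"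
      using r(1) unfolding \<beta>_def dist_norm
      by (simp only: diff_add_eq_diff_diff_swap diff_self diff_0_right norm_minus_cancel norm_mult norm_of_real
          abs_of_pos half_gt_zero norm_minus_commute[of c t]) (simp add: norm_mult)
    moreover have "r / 2 * dist c t < r / 2 * 2"
      using that r(1) by (intro mult_strict_left_mono) auto
    ultimately show ?thesis by simp
  qed
  define \<xi> where "\<xi> = \<alpha> \<circ> \<phi>"
  define \<sigma> where "\<sigma> = inv_into U \<phi> \<circ> \<beta>"
  define V where "V = {x \<in> U. \<xi> x \<in> ball c 1}"
  have \<sigma>\<xi>: "\<sigma> (\<xi> x) = x" if "x \<in> U" for x
    using that inj by (simp add: \<sigma>_def \<xi>_def)
  have \<sigma>: "\<sigma> t \<in> U \<inter> N" "\<xi> (\<sigma> t) = t" if t: "t \<in> ball c 2" for t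
  proof -
    obtain x where "x \<in> U \<inter> N" "\<beta> t = \<phi> x" using \<beta>_ball[OF t] r(2) by blast
    moreover from this have "\<sigma> t = x" using inj by (simp add: \<sigma>_def)
    ultimately show "\<sigma> t \<in> U \<inter> N" "\<xi> (\<sigma> t) = t" by (simp_all add: \<xi>_def) (metis \<alpha>\<beta>(1))
  qed
  have VN: "V \<subseteq> N"
  proof
    fix x assume "x \<in> V"
    hence "x \<in> U" "\<xi> x \<in> ball c 2" by (auto simp: V_def)
    thus "x \<in> N" using \<sigma>(1)[of "\<xi> x"] \<sigma>\<xi>[of x] by auto
  qed
  have \<xi>V: "\<xi> ` V = ball c 1"
  proof
    show "ball c 1 \<subseteq> \<xi> ` V"
    proof
      fix t assume t: "t \<in> ball c 1"
      hence "\<sigma> t \<in> U" "\<xi> (\<sigma> t) = t" using \<sigma>[of t] by auto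
      thus "t \<in> \<xi> ` V" unfolding V_def using t by (metis (mono_tags, lifting) imageI mem_Collect_eq)
    qed
  qed (auto simp: V_def)
  have VU: "V \<subseteq> U" by (auto simp: V_def)
  have hom\<xi>: "homeomorphic_map (subtopology (topol X) U) (top_of_set (\<xi> ` U)) \<xi>"
  proof -
    have "homeomorphic_maps (top_of_set (\<phi> ` U)) (top_of_set (\<xi> ` U)) \<alpha> \<beta>"
      unfolding homeomorphic_maps_def
      by (auto simp: \<xi>_def intro!: holomorphic_on_imp_continuous_on \<alpha>_hol \<beta>_hol)
    hence "homeomorphic_map (top_of_set (\<phi> ` U)) (top_of_set (\<xi> ` U)) \<alpha>"
      using homeomorphic_map_maps by blast
    thus ?thesis unfolding \<xi>_def using homeomorphic_map_compose[OF hom] by blast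
  qed
  have "openin (topol X) V"
  proof -
    have "openin (subtopology (topol X) U) {x \<in> topspace (subtopology (topol X) U). \<xi> x \<in> ball c 1 \<inter> \<xi> ` U}"
      by (rule openin_continuous_map_preimage[OF homeomorphic_imp_continuous_map[OF hom\<xi>]])
        (metis Int_commute open_ball openin_open_Int)
    moreover have "{x \<in> topspace (subtopology (topol X) U). \<xi> x \<in> ball c 1 \<inter> \<xi> ` U} = V"
      using UT by (auto simp: V_def)
    ultimately show ?thesis using oU openin_trans_full by metis
  qed
  moreover have "homeomorphic_map (subtopology (topol X) V) (top_of_set (\<xi> ` V)) \<xi>"
  proof -
    have "homeomorphic_map (subtopology (subtopology (topol X) U) V) (subtopology (top_of_set (\<xi> ` U)) (\<xi> ` V)) \<xi>"
      by (rule homeomorphic_map_subtopologies[OF hom\<xi>]) (use UT VU in auto)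
    thus ?thesis using VU image_mono[OF VU, of \<xi>] by (simp add: subtopology_subtopology Int_absorb1)
  qed
  ultimately have chV: "is_chart (topol X) V \<xi>" by (simp add: is_chart_def \<xi>V)
  have inv\<xi>: "inv_into V \<xi> t = \<sigma> t" if "t \<in> \<xi> ` V" for t
    using that chart_inj[OF chV] VU by (auto simp: \<sigma>\<xi>)
  have "holomorphic_chart X V \<xi>"
    unfolding holomorphic_chart_def
  proof (intro conjI chV, clarify)
    fix U' \<psi> assume U': "(U', \<psi>) \<in> atlas X"
    have comp: "(\<psi> \<circ> inv_into U \<phi>) holomorphic_on \<phi> ` (U \<inter> U')"
               "(\<phi> \<circ> inv_into U' \<psi>) holomorphic_on \<psi> ` (U \<inter> U')"
      using riemann_surface_compatible[OF X U U'] by (simp_all add: compatible_def)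
    have "(\<psi> \<circ> inv_into U \<phi> \<circ> \<beta>) holomorphic_on \<xi> ` (V \<inter> U')"
      by (rule holomorphic_on_compose_gen[OF \<beta>_hol comp(1)]) (use VU in \<open>auto simp: \<xi>_def\<close>)
    hence "(\<psi> \<circ> inv_into V \<xi>) holomorphic_on \<xi> ` (V \<inter> U')"
      by (rule holomorphic_transform) (use inv\<xi> in \<open>auto simp: \<sigma>_def\<close>)
    moreover have "(\<alpha> \<circ> (\<phi> \<circ> inv_into U' \<psi>)) holomorphic_on \<psi> ` (V \<inter> U')"
      by (rule holomorphic_on_compose_gen[OF _ \<alpha>_hol[of UNIV]], rule holomorphic_on_subset[OF comp(2)])
        (use VU in auto)
    ultimately show "compatible V \<xi> U' \<psi>"
      by (simp add: compatible_def \<xi>_def o_assoc)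
  qed
  moreover have "\<xi> b = c" by (simp add: \<xi>_def \<alpha>_def)
  moreover have "b \<in> V" using bU \<open>\<xi> b = c\<close> by (simp add: V_def)
  moreover have "(g \<circ> \<sigma>) holomorphic_on ball c 2" if g: "holomorphic_function X g" for g
  proof -
    have "(g \<circ> inv_into U \<phi>) holomorphic_on \<phi> ` U" using g U by (auto simp: holomorphic_function_def)
    hence "(g \<circ> inv_into U \<phi> \<circ> \<beta>) holomorphic_on ball c 2"
      by (rule holomorphic_on_compose_gen[OF \<beta>_hol]) (use \<beta>_ball r(2) in blast)
    thus ?thesis by (simp add: \<sigma>_def o_assoc)
  qed
  moreover have "\<sigma> ` ball c 2 \<subseteq> topspace (topol X)" using \<sigma>(1) UT by blast
  moreover have "\<sigma> (\<xi> x) = x" if "x \<in> V" for x using \<sigma>\<xi> VU that by blast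
  ultimately show ?thesis using VN \<xi>V by (intro that[of V \<xi> \<sigma>])
qed

section \<open>Local description of maps into the symmetric product\<close>

lemma sum_mset_sym_proj: "(\<Sum>p\<in>#sym_proj n x. h p) = (\<Sum>j\<in>{1..n}. h (x j))"
  unfolding sym_proj_def by (simp add: sum_unfold_sum_mset multiset.map_comp o_def)

lemma prod_mset_sym_proj: "(\<Prod>p\<in>#sym_proj n x. h p) = (\<Prod>j\<in>{1..n}. h (x j))"
  unfolding sym_proj_def by (simp add: prod_unfold_prod_mset multiset.map_comp o_def)

lemma set_mset_sym_proj: "set_mset (sym_proj n x) = x ` {1..n}"
  by (simp add: sym_proj_def)

lemma sym_points_obtain:
  assumes "p \<in> sym_points n S"
  obtains x where "p = sym_proj n x" "\<And>j. j \<in> {1..n} \<Longrightarrow> x j \<in> S"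
  using assms unfolding sym_proj_image[symmetric] by (auto simp: PiE_iff)

lemma holomorphic_maps_dim_sym_points:
  assumes "f \<in> holomorphic_maps_dim n disc (Sym n X)" "l \<in> ball 0 1"
  shows "f l \<in> sym_points n (topspace (topol X))"
proof -
  have "continuous_map (top_of_set (ball 0 1)) (sym_topology n (topol X)) f"
    using assms(1) by (simp add: holomorphic_maps_dim_def holomorphic_maps_wrt_def disc_def Sym_def)
  thus ?thesis using assms(2) by (auto simp: continuous_map_def topspace_sym_topology)
qed

text \<open>
A description of \<open>f\<close> on \<open>W\<close> in the coordinates of a chart of the symmetric product: the point \<open>f l\<close> has the
entries \<open>\<rho> (z l j)\<close>, where \<open>\<rho>\<close> combines the inverses of charts of \<open>X\<close> whose images are discs with
well separated centres \<open>c j\<close>. Holomorphy of \<open>f\<close> becomes that of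
the elementary symmetric functions of \<open>z l\<close>. The parametrisation \<open>\<rho>\<close> lives on discs of radius 2
although the \<open>z l j\<close> stay within distance 1 of the centres; this leaves room for contours.
\<close>

definition chart_lift ::
    "'a surface \<Rightarrow> nat \<Rightarrow> (complex \<Rightarrow> 'a multiset) \<Rightarrow> complex set \<Rightarrow>
     (nat \<Rightarrow> complex) \<Rightarrow> (complex \<Rightarrow> nat \<Rightarrow> complex) \<Rightarrow> (complex \<Rightarrow> 'a) \<Rightarrow> bool" where
  "chart_lift X n f W c z \<rho> \<longleftrightarrow>
     (\<forall>i\<in>{1..n}. \<forall>j\<in>{1..n}. c i \<noteq> c j \<longrightarrow> dist (c i) (c j) \<ge> 4) \<and>
     (\<forall>l\<in>W. \<forall>j\<in>{1..n}. z l j \<in> ball (c j) 1) \<and>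
     (\<forall>k\<in>{1..n}. (\<lambda>l. elem_sym n k (z l)) holomorphic_on W) \<and>
     (\<forall>l\<in>W. f l = sym_proj n (\<lambda>j. \<rho> (z l j))) \<and>
     (\<forall>j\<in>{1..n}. \<rho> ` ball (c j) 2 \<subseteq> topspace (topol X)) \<and>
     (\<forall>g. holomorphic_function X g \<longrightarrow> (g \<circ> \<rho>) holomorphic_on (\<Union>j\<in>{1..n}. ball (c j) 2))"

lemma chart_liftD:
  assumes "chart_lift X n f W c z \<rho>"
  shows "\<And>i j. i \<in> {1..n} \<Longrightarrow> j \<in> {1..n} \<Longrightarrow> c i \<noteq> c j \<Longrightarrow> dist (c i) (c j) \<ge> 4"
    "\<And>l j. l \<in> W \<Longrightarrow> j \<in> {1..n} \<Longrightarrow> z l j \<in> ball (c j) 1"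
    "\<And>k. k \<in> {1..n} \<Longrightarrow> (\<lambda>l. elem_sym n k (z l)) holomorphic_on W"
    "\<And>l. l \<in> W \<Longrightarrow> f l = sym_proj n (\<lambda>j. \<rho> (z l j))"
    "\<And>j. j \<in> {1..n} \<Longrightarrow> \<rho> ` ball (c j) 2 \<subseteq> topspace (topol X)"
    "\<And>g. holomorphic_function X g \<Longrightarrow> (g \<circ> \<rho>) holomorphic_on (\<Union>j\<in>{1..n}. ball (c j) 2)"
  using assms unfolding chart_lift_def by blast+

text \<open>
The chart of the symmetric product is assembled from charts of \<open>X\<close> at the distinct entries of \<open>f l0\<close>,
chosen with disjoint domains and with images centred at different multiples of 4.
\<close>

lemma chart_lift_exists:
  fixes X :: "'a surface"
  assumes X: "riemann_surface X" and f: "f \<in> holomorphic_maps_dim n disc (Sym n X)"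
    and l0: "l0 \<in> ball 0 1"
  obtains W c z \<rho> where "open W" "l0 \<in> W" "W \<subseteq> ball 0 1" "chart_lift X n f W c z \<rho>"
    "\<And>j. j \<in> {1..n} \<Longrightarrow> z l0 j = c j"
proof -
  obtain p where p: "f l0 = sym_proj n p" and pT: "\<And>j. j \<in> {1..n} \<Longrightarrow> p j \<in> topspace (topol X)"
    using sym_points_obtain[OF holomorphic_maps_dim_sym_points[OF f l0]] by blast
  define B where "B = p ` {1..n}"
  have B: "finite B" "B \<subseteq> topspace (topol X)" using pT by (auto simp: B_def)
  have "Hausdorff_space (topol X)" using X by (simp add: riemann_surface_def)
  then obtain N where N: "\<And>b. b \<in> B \<Longrightarrow> openin (topol X) (N b) \<and> b \<in> N b"
    and N_disj: "\<And>b b'. b \<in> B \<Longrightarrow> b' \<in> B \<Longrightarrow> b \<noteq> b' \<Longrightarrow> N b \<inter> N b' = {}"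
    using Hausdorff_space_separate_finite[OF _ B] by blast
  obtain e :: "'a \<Rightarrow> nat" where e: "inj_on e B"
    using finite_imp_inj_to_nat_seg[OF B(1)] by blast
  define \<kappa> :: "'a \<Rightarrow> complex" where "\<kappa> b = of_nat (4 * e b)" for b
  have \<kappa>: "dist (\<kappa> b) (\<kappa> b') \<ge> 4" if "b \<in> B" "b' \<in> B" "b \<noteq> b'" for b b'
  proof -
    have "e b \<noteq> e b'" using e that by (auto dest: inj_onD)
    hence "\<bar>real (e b) - real (e b')\<bar> \<ge> 1" by linarith
    moreover have "dist (\<kappa> b) (\<kappa> b') = \<bar>real (4 * e b) - real (4 * e b')\<bar>"
      unfolding \<kappa>_def dist_of_nat dist_norm by (metis norm_of_real of_real_diff of_real_of_nat_eq)
    ultimately show ?thesis by simp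
  qed
  \<comment> \<open>Charts of \<open>X\<close> are indexed by the distinct entries \<open>b\<close> of \<open>f l0\<close>, not by positions, so that equal
    entries automatically get equal charts.\<close>
  define Q where "Q b V \<xi> \<sigma> \<longleftrightarrow> holomorphic_chart X V \<xi> \<and> b \<in> V \<and> V \<subseteq> N b \<and>
      \<xi> b = \<kappa> b \<and> \<xi> ` V = ball (\<kappa> b) 1 \<and> (\<forall>x\<in>V. \<sigma> (\<xi> x) = x) \<and>
      \<sigma> ` ball (\<kappa> b) 2 \<subseteq> topspace (topol X) \<and>
      (\<forall>g. holomorphic_function X g \<longrightarrow> (g \<circ> \<sigma>) holomorphic_on ball (\<kappa> b) 2)" for b V \<xi> \<sigma>
  have "\<exists>V \<xi> \<sigma>. Q b V \<xi> \<sigma>" if b: "b \<in> B" for b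
  proof -
    have "b \<in> N b" "openin (topol X) (N b)" using N[OF b] by auto
    from adapted_chart[OF X this, of "\<kappa> b"] show ?thesis unfolding Q_def by metis
  qed
  then obtain V \<xi> \<sigma> where Q: "\<And>b. b \<in> B \<Longrightarrow> Q b (V b) (\<xi> b) (\<sigma> b)" by metis
  have chart: "holomorphic_chart X (V b) (\<xi> b)" and V: "b \<in> V b" "V b \<subseteq> N b"
    and \<xi>: "\<xi> b b = \<kappa> b" "\<xi> b ` V b = ball (\<kappa> b) 1"
    and \<sigma>: "\<And>x. x \<in> V b \<Longrightarrow> \<sigma> b (\<xi> b x) = x" "\<sigma> b ` ball (\<kappa> b) 2 \<subseteq> topspace (topol X)"
      "\<And>g. holomorphic_function X g \<Longrightarrow> (g \<circ> \<sigma> b) holomorphic_on ball (\<kappa> b) 2" if "b \<in> B" for b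
    using Q[OF that] unfolding Q_def by auto
  define \<rho> where "\<rho> t = \<sigma> (SOME b. b \<in> B \<and> t \<in> ball (\<kappa> b) 2) t" for t
  have \<rho>: "\<rho> t = \<sigma> b t" if b: "b \<in> B" and t: "t \<in> ball (\<kappa> b) 2" for b t
  proof -
    have uniq: "b' = b" if "b' \<in> B \<and> t \<in> ball (\<kappa> b') 2" for b'
    proof (rule ccontr)
      assume "b' \<noteq> b"
      hence "dist (\<kappa> b') (\<kappa> b) \<ge> 4" using \<kappa> b that by blast
      thus False using t that dist_triangle[of "\<kappa> b'" "\<kappa> b" t] dist_commute[of t "\<kappa> b"] by simp
    qed
    have "(SOME b. b \<in> B \<and> t \<in> ball (\<kappa> b) 2) = b"
      by (rule some_equality) (use b t uniq in blast)+
    thus ?thesis by (simp add: \<rho>_def)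
  qed
  define c where "c j = \<kappa> (p j)" for j
  define U where "U j = V (p j)" for j
  define \<phi> where "\<phi> j = \<xi> (p j)" for j
  have pB: "p j \<in> B" if "j \<in> {1..n}" for j using that by (auto simp: B_def)
  have fam: "sym_chart_family n X p U \<phi>"
    unfolding sym_chart_family_def
  proof (intro conjI ballI)
    fix j k assume jk: "j \<in> {1..n}" "k \<in> {1..n}"
    show "if p j = p k then U j = U k \<and> \<phi> j = \<phi> k else U j \<inter> U k = {} \<and> \<phi> j ` U j \<inter> \<phi> k ` U k = {}"
    proof (cases "p j = p k")
      case False
      have "U j \<inter> U k = {}" using V(2) N_disj[OF pB pB False] jk pB unfolding U_def by blast
      moreover have "dist (c j) (c k) \<ge> 4" using \<kappa>[OF pB pB False] jk by (simp add: c_def)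
      hence "ball (c j) 1 \<inter> ball (c k) 1 = {}" by (intro disjoint_ballI) simp
      hence "\<phi> j ` U j \<inter> \<phi> k ` U k = {}" using \<xi>(2)[OF pB] jk by (simp add: \<phi>_def U_def c_def)
      ultimately show ?thesis using False by simp
    qed (simp add: U_def \<phi>_def)
  qed (use chart V(1) pB in \<open>auto simp: U_def \<phi>_def\<close>)
  define D where "D = {l \<in> ball 0 1. f l \<in> sym_nbhd n U}"
  have "openin (top_of_set (ball 0 1)) D"
  proof -
    have "openin (sym_topology n (topol X)) (sym_nbhd n U)"
    proof (rule openin_sym_nbhd)
      fix j assume "j \<in> {1..n}"
      from chart[OF pB[OF this]] show "openin (topol X) (U j)"
        unfolding U_def holomorphic_chart_def is_chart_def by blast
    qed
    moreover have "continuous_map (top_of_set (ball 0 1)) (sym_topology n (topol X)) f"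
      using f by (simp add: holomorphic_maps_dim_def holomorphic_maps_wrt_def disc_def Sym_def)
    ultimately have "openin (top_of_set (ball 0 1)) {l \<in> topspace (top_of_set (ball 0 1)). f l \<in> sym_nbhd n U}"
      by (rule openin_continuous_map_preimage[rotated])
    thus ?thesis by (simp add: D_def)
  qed
  hence oD: "open D" using openin_open_trans by blast
  have pU: "\<forall>j\<in>{1..n}. p j \<in> U j" using V(1)[OF pB] by (simp add: U_def)
  have "l0 \<in> D"
    unfolding D_def sym_nbhd_def using l0 p pU by blast
  \<comment> \<open>An ordering \<open>x\<close> of the entries of \<open>f l\<close> is chosen separately for each \<open>l\<close>, without any continuity.
    At \<open>l0\<close> the given ordering \<open>p\<close> is taken.\<close>
  have "\<exists>x. (\<forall>j\<in>{1..n}. x j \<in> U j) \<and> f l = sym_proj n x \<and> (l = l0 \<longrightarrow> x = p)" if "l \<in> D" for l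
  proof (cases "l = l0")
    case False
    thus ?thesis using that unfolding D_def sym_nbhd_def by blast
  qed (use p pU in blast)
  then obtain x where x: "\<And>l j. l \<in> D \<Longrightarrow> j \<in> {1..n} \<Longrightarrow> x l j \<in> U j"
    "\<And>l. l \<in> D \<Longrightarrow> f l = sym_proj n (x l)" "l0 \<in> D \<Longrightarrow> x l0 = p"
    by metis
  define z where "z l j = \<phi> j (x l j)" for l j
  have z: "z l j \<in> ball (c j) 1" if "l \<in> D" "j \<in> {1..n}" for l j
    using x(1)[OF that] \<xi>(2)[OF pB[OF that(2)]] by (auto simp: z_def \<phi>_def U_def c_def)
  have \<rho>z: "\<rho> (z l j) = x l j" if "l \<in> D" "j \<in> {1..n}" for l j
  proof -
    have "z l j \<in> ball (\<kappa> (p j)) 2" using z[OF that] by (simp add: c_def)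
    hence "\<rho> (z l j) = \<sigma> (p j) (z l j)" by (rule \<rho>[OF pB[OF that(2)]])
    thus ?thesis using \<sigma>(1)[OF pB[OF that(2)]] x(1)[OF that] by (simp add: z_def \<phi>_def U_def)
  qed
  have "(\<lambda>l. elem_sym n k (z l)) holomorphic_on D" if k: "k \<in> {1..n}" for k
  proof -
    have "(sym_nbhd n U, sym_chart n U \<phi>) \<in> atlas (Sym n X)"
      using fam by (auto simp: Sym_def)
    moreover have "(ball 0 1, \<lambda>z. z) \<in> atlas disc" by (simp add: disc_def)
    moreover have "(\<lambda>w. w k) \<in> {\<lambda>w. w k |k. k \<in> {1..n}}" using k by blast
    ultimately have "((\<lambda>w. w k) \<circ> sym_chart n U \<phi> \<circ> f \<circ> inv_into (ball 0 1) (\<lambda>z. z)) holomorphic_on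
        (\<lambda>z. z) ` {l \<in> ball 0 1. f l \<in> sym_nbhd n U}"
      using f unfolding holomorphic_maps_dim_def holomorphic_maps_wrt_def by blast
    hence "((\<lambda>w. w k) \<circ> sym_chart n U \<phi> \<circ> f \<circ> inv_into (ball 0 1) (\<lambda>z. z)) holomorphic_on D"
      by (simp only: D_def image_ident)
    thus ?thesis
    proof (rule holomorphic_transform)
      fix l assume l: "l \<in> D"
      hence "inv_into (ball 0 1) (\<lambda>z. z) l = l" by (intro inv_into_identity) (simp add: D_def)
      thus "((\<lambda>w. w k) \<circ> sym_chart n U \<phi> \<circ> f \<circ> inv_into (ball 0 1) (\<lambda>z. z)) l = elem_sym n k (z l)"
        using sym_chart_sym_proj[OF fam x(1)[OF l], of k] x(2)[OF l] by (simp add: z_def[abs_def])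
    qed
  qed
  moreover have "(g \<circ> \<rho>) holomorphic_on (\<Union>j\<in>{1..n}. ball (c j) 2)" if g: "holomorphic_function X g" for g
  proof (rule holomorphic_on_UN_open)
    fix j assume j: "j \<in> {1..n}"
    show "(g \<circ> \<rho>) holomorphic_on ball (c j) 2"
      unfolding c_def by (rule holomorphic_transform[OF \<sigma>(3)[OF pB[OF j] g]]) (use \<rho>[OF pB[OF j]] in simp)
  qed simp
  moreover have "f l = sym_proj n (\<lambda>j. \<rho> (z l j))" if "l \<in> D" for l
    unfolding x(2)[OF that] sym_proj_def using \<rho>z[OF that] by (intro image_mset_cong) simp
  moreover have "\<rho> ` ball (c j) 2 \<subseteq> topspace (topol X)" if "j \<in> {1..n}" for j
    using \<sigma>(2)[OF pB[OF that]] \<rho>[OF pB[OF that]] by (force simp: c_def)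
  moreover have "dist (c i) (c j) \<ge> 4" if "i \<in> {1..n}" "j \<in> {1..n}" "c i \<noteq> c j" for i j
    using \<kappa>[OF pB[OF that(1)] pB[OF that(2)]] that(3) unfolding c_def by force
  ultimately have "chart_lift X n f D c z \<rho>" unfolding chart_lift_def using z by simp
  moreover have "z l0 j = c j" if "j \<in> {1..n}" for j
    using x(3)[OF \<open>l0 \<in> D\<close>] \<xi>(1)[OF pB[OF that]] by (simp add: z_def \<phi>_def c_def)
  moreover have "D \<subseteq> ball 0 1" by (auto simp: D_def)
  ultimately show ?thesis using oD \<open>l0 \<in> D\<close> that by blast
qed

lemma holomorphic_function_const: "holomorphic_function X (\<lambda>_. w)"
  unfolding holomorphic_function_def o_def by (auto intro!: holomorphic_intros)

lemma holomorphic_function_power: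
  "holomorphic_function X g \<Longrightarrow> holomorphic_function X (\<lambda>p. g p ^ N)"
  unfolding holomorphic_function_def o_def by (auto intro!: holomorphic_intros)

lemma holomorphic_function_prod:
  "(\<And>i. i \<in> I \<Longrightarrow> holomorphic_function X (g i)) \<Longrightarrow> holomorphic_function X (\<lambda>p. \<Prod>i\<in>I. g i p)"
  unfolding holomorphic_function_def o_def by (fastforce intro!: holomorphic_intros)

text \<open>
Locally this is \<open>trace_holomorphic\<close> for the lift of \<open>f\<close> to charts.
\<close>

lemma holomorphic_sum_over_entries:
  assumes X: "riemann_surface X" and f: "f \<in> holomorphic_maps_dim n disc (Sym n X)"
    and g: "holomorphic_function X g"
  shows "(\<lambda>l. \<Sum>p\<in>#f l. g p) holomorphic_on ball 0 1"
proof -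
  have "\<exists>d>0. (\<lambda>l. \<Sum>p\<in>#f l. g p) holomorphic_on ball l0 d" if l0: "l0 \<in> ball 0 1" for l0
  proof -
    obtain W c z \<rho> where W: "open W" "l0 \<in> W" and lift: "chart_lift X n f W c z \<rho>"
      using chart_lift_exists[OF X f l0] by metis
    note L = chart_liftD[OF lift]
    obtain d where d: "d > 0" "ball l0 d \<subseteq> W" using W by (meson open_contains_ball)
    have "(\<lambda>l. \<Sum>j\<in>{1..n}. (g \<circ> \<rho>) (z l j)) holomorphic_on ball l0 d"
      using d(2) by (intro trace_holomorphic[OF open_ball convex_ball _ L(2) L(1) L(6)[OF g]]
        holomorphic_on_subset[OF L(3)]) auto
    hence "(\<lambda>l. \<Sum>p\<in>#f l. g p) holomorphic_on ball l0 d"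
      by (rule holomorphic_transform) (use L(4) d(2) in \<open>auto simp: sum_mset_sym_proj\<close>)
    thus ?thesis using d(1) by blast
  qed
  thus ?thesis
    by (meson analytic_on_def analytic_imp_holomorphic)
qed

section \<open>The Schwarz lemma for products over the entries\<close>

text \<open>
A Lipschitz bound at the origin for the disc automorphism that takes \<open>0\<close> to \<open>w\<close>. It transports an order of
vanishing at \<open>w\<close> to the origin.
\<close>

lemma Moebius_function_neg_dist_le:
  assumes w: "norm w < 1" and z: "norm z < 1"
  shows "norm (Moebius_function 0 (-w) z - w) \<le> 2 * norm z"
proof -
  have 1: "norm (1 + cnj w * z) \<ge> 1 - norm w"
  proof -
    have "norm (cnj w * z) \<le> norm w * 1"
      unfolding norm_mult using z by (intro mult_mono) auto
    thus ?thesis using norm_diff_ineq[of 1 "cnj w * z"] by simp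
  qed
  hence nz: "1 + cnj w * z \<noteq> 0" using w by auto
  have "cnj w * w = of_real ((norm w)\<^sup>2)" by (simp only: mult.commute[of "cnj w"] complex_norm_square)
  hence "Moebius_function 0 (-w) z - w = z * of_real (1 - (norm w)\<^sup>2) / (1 + cnj w * z)"
    using nz by (simp add: Moebius_function_simple divide_simps) (simp add: algebra_simps)
  hence "norm (Moebius_function 0 (-w) z - w) = norm z * (1 - (norm w)\<^sup>2) / norm (1 + cnj w * z)"
    using w by (simp add: norm_divide norm_mult power_le_one abs_of_nonneg del: of_real_diff of_real_power)
  also have "\<dots> \<le> norm z * (1 - (norm w)\<^sup>2) / (1 - norm w)"
    using w 1 by (intro divide_left_mono mult_nonneg_nonneg mult_pos_pos) (auto simp: power_le_one)
  also have "\<dots> = norm z * (1 + norm w)"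
    using w by (simp add: field_simps power2_eq_square)
  also have "\<dots> \<le> norm z * 2" using w by (intro mult_left_mono) auto
  finally show ?thesis by (simp add: mult.commute)
qed

text \<open>
The product over all entries of \<open>f x0\<close>, with multiplicities, is what makes the order of vanishing one:
an entry that occurs \<open>k\<close> times splits into \<open>k\<close> points at distance about \<open>norm (l - x0)\<close> to the power
\<open>1 / k\<close> in general, but \<open>k\<close> of the factors vanish there. In the coordinates \<open>z l j\<close> each factor is at
most \<open>norm (z l j - c i)\<close>: by the Schwarz lemma if \<open>c i = c j\<close>, and otherwise because this distance exceeds 1.
The product of these distances is controlled by \<open>prod_diff_le_of_elem_sym\<close>.
\<close>

lemma entries_product_near_zero:
  assumes X: "riemann_surface X" and f: "f \<in> holomorphic_maps_dim n disc (Sym n X)"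
    and x0: "x0 \<in> ball 0 1"
    and g: "\<And>b. b \<in># f x0 \<Longrightarrow> g b \<in> holomorphic_maps X disc \<and> g b b = 0"
  obtains C d where "d > 0" "C \<ge> 0"
    "\<And>l p. l \<in> ball x0 d \<Longrightarrow> p \<in># f l \<Longrightarrow> (\<Prod>b\<in>#f x0. norm (g b p)) \<le> C * norm (l - x0)"
proof -
  obtain W c z \<rho> where W: "open W" "x0 \<in> W" and lift: "chart_lift X n f W c z \<rho>"
    and zc: "\<And>j. j \<in> {1..n} \<Longrightarrow> z x0 j = c j"
    using chart_lift_exists[OF X f x0] by metis
  note L = chart_liftD[OF lift]
  have fx0: "f x0 = sym_proj n (\<lambda>j. \<rho> (c j))"
    unfolding L(4)[OF W(2)] sym_proj_def using zc by (intro image_mset_cong) simp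
  have gc: "g (\<rho> (c i)) \<in> holomorphic_maps X disc" "g (\<rho> (c i)) (\<rho> (c i)) = 0" if "i \<in> {1..n}" for i
    using g[of "\<rho> (c i)"] that by (auto simp: fx0 set_mset_sym_proj)
  have factor_le: "norm (g (\<rho> (c i)) (\<rho> (z l j))) \<le> norm (z l j - c i)"
    if l: "l \<in> W" and i: "i \<in> {1..n}" and j: "j \<in> {1..n}" for l i j
  proof -
    have lt: "norm (g (\<rho> (c i)) (\<rho> t)) < 1" if "t \<in> ball (c k) 2" "k \<in> {1..n}" for t k
      by (rule holomorphic_maps_disc_norm_less[OF gc(1)[OF i]]) (use L(5)[OF that(2)] that(1) in blast)
    show ?thesis
    proof (cases "c i = c j")
      case True
      define h where "h t = (g (\<rho> (c i)) \<circ> \<rho>) (c i + t)" for t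
      have "(g (\<rho> (c i)) \<circ> \<rho>) holomorphic_on (\<Union>j\<in>{1..n}. ball (c j) 2)"
        using gc(1)[OF i] holomorphic_maps_disc_iff[OF X] by (intro L(6)) blast
      hence "((g (\<rho> (c i)) \<circ> \<rho>) \<circ> (\<lambda>t. c i + t)) holomorphic_on ball 0 1"
        by (rule holomorphic_on_compose_gen[rotated]) (use i in \<open>auto intro!: holomorphic_intros bexI[of _ i] simp: dist_norm\<close>)
      hence h: "h holomorphic_on ball 0 1" by (simp add: h_def[abs_def] o_def)
      have "norm (h t) < 1" if "norm t < 1" for t
        unfolding h_def o_apply using that i by (intro lt[of _ i]) (auto simp: dist_norm)
      moreover have "h 0 = 0" using gc(2)[OF i] by (simp add: h_def)
      moreover have "norm (z l j - c i) < 1"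
        using L(2)[OF l j] True by (simp add: dist_norm norm_minus_commute)
      ultimately have "norm (h (z l j - c i)) \<le> norm (z l j - c i)"
        using Schwarz_Lemma(1)[OF h] by blast
      thus ?thesis by (simp add: h_def)
    next
      case False
      have "norm (g (\<rho> (c i)) (\<rho> (z l j))) < 1"
        using L(2)[OF l j] by (intro lt[OF _ j]) auto
      moreover have "norm (z l j - c i) \<ge> 1"
        using L(1)[OF i j False] L(2)[OF l j] dist_triangle[of "c i" "c j" "z l j"]
        by (simp add: dist_norm norm_minus_commute)
      ultimately show ?thesis by simp
    qed
  qed
  define R where "R = Max (insert 0 ((\<lambda>j. norm (c j)) ` {1..n})) + 1"
  have zR: "norm (z l j) \<le> R" if "l \<in> W" "j \<in> {1..n}" for l j
  proof -
    have "norm (c j) \<le> R - 1" 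
      unfolding R_def using that(2) by (simp del: Max_insert)
    thus ?thesis using L(2)[OF that] norm_triangle_sub[of "z l j" "c j"]
      by (simp add: dist_norm norm_minus_commute)
  qed
  obtain C d where d: "d > 0" "ball x0 d \<subseteq> W" and "C \<ge> 0"
    and bound: "\<And>l j. l \<in> ball x0 d \<Longrightarrow> j \<in> {1..n} \<Longrightarrow> (\<Prod>i\<in>{1..n}. norm (z l j - c i)) \<le> C * norm (l - x0)"
    by (rule prod_diff_le_of_elem_sym[OF W L(3) zR zc]) (assumption | (rule that; blast))+
  have "(\<Prod>b\<in>#f x0. norm (g b p)) \<le> C * norm (l - x0)" if l: "l \<in> ball x0 d" and p: "p \<in># f l" for l p
  proof -
    have lW: "l \<in> W" using l d by blast
    obtain j where j: "j \<in> {1..n}" "p = \<rho> (z l j)"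
      using p unfolding L(4)[OF lW] set_mset_sym_proj by blast
    have "(\<Prod>b\<in>#f x0. norm (g b p)) = (\<Prod>i\<in>{1..n}. norm (g (\<rho> (c i)) (\<rho> (z l j))))"
      unfolding fx0 prod_mset_sym_proj j(2) ..
    also have "\<dots> \<le> (\<Prod>i\<in>{1..n}. norm (z l j - c i))"
      by (intro prod_mono conjI factor_le lW j) auto
    also have "\<dots> \<le> C * norm (l - x0)" by (rule bound[OF l j(1)])
    finally show ?thesis .
  qed
  thus ?thesis using that d(1) \<open>C \<ge> 0\<close> by blast
qed

text \<open>
Let \<open>G\<close> be the product of the functions \<open>g b\<close>. All power sums of \<open>G\<close> over the entries of \<open>f l\<close> are holomorphic
in \<open>l\<close>, bounded by \<open>n\<close>, and vanish at \<open>x0\<close> to the order of the exponent. The Schwarz lemma bounds them,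
and \<open>norm_le_of_power_sums_le\<close> returns to the single values of \<open>G\<close>, at the same time removing the factor \<open>n\<close>.
\<close>

lemma prod_over_entries_le_Moebius:
  assumes X: "riemann_surface X" and f: "f \<in> holomorphic_maps_dim n disc (Sym n X)"
    and x: "x \<in> ball 0 1" and x0: "x0 \<in> ball 0 1" and a: "a \<in># f x"
    and g: "\<And>b. b \<in># f x0 \<Longrightarrow> g b \<in> holomorphic_maps X disc \<and> g b b = 0"
  shows "(\<Prod>b\<in>#f x0. norm (g b a)) \<le> norm (Moebius_function 0 x0 x)"
proof -
  define G where "G p = (\<Prod>b\<in>#f x0. g b p)" for p
  obtain b where fx0: "f x0 = sym_proj n b" and b: "\<And>j. j \<in> {1..n} \<Longrightarrow> b j \<in> topspace (topol X)"
    using sym_points_obtain[OF holomorphic_maps_dim_sym_points[OF f x0]] by blast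
  have G: "G = (\<lambda>p. \<Prod>j\<in>{1..n}. g (b j) p)"
    unfolding G_def fx0 prod_mset_sym_proj ..
  have gb: "g (b j) \<in> holomorphic_maps X disc" if "j \<in> {1..n}" for j
    using g[of "b j"] that by (auto simp: fx0 set_mset_sym_proj)
  have norm_G: "norm (G p) = (\<Prod>b\<in>#f x0. norm (g b p))" for p
    unfolding G fx0 prod_mset_sym_proj by (rule prod_norm[symmetric])
  have G_hol: "holomorphic_function X G"
    unfolding G using gb holomorphic_maps_disc_iff[OF X] by (intro holomorphic_function_prod) blast
  have G_le: "norm (G p) \<le> 1" if "p \<in> topspace (topol X)" for p
    unfolding G prod_norm[symmetric]
    by (intro prod_le_1 conjI norm_ge_zero less_imp_le[OF holomorphic_maps_disc_norm_less[OF gb that]])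
  obtain C d where d: "d > 0" and C: "C \<ge> 0"
    and near: "\<And>l p. l \<in> ball x0 d \<Longrightarrow> p \<in># f l \<Longrightarrow> norm (G p) \<le> C * norm (l - x0)"
    using entries_product_near_zero[OF X f x0 g] unfolding norm_G by metis
  define m where "m = norm (Moebius_function 0 x0 x)"
  have nx0: "norm x0 < 1" and nx: "norm x < 1" using x x0 by auto
  define S where "S N l = (\<Sum>p\<in>#f l. G p ^ N)" for N l
  have S_le: "norm (S N l) \<le> of_nat n * r ^ N"
    if l: "l \<in> ball 0 1" and r: "\<And>p. p \<in># f l \<Longrightarrow> norm (G p) \<le> r" for N l r
  proof -
    obtain y where y: "f l = sym_proj n y"
      using sym_points_obtain[OF holomorphic_maps_dim_sym_points[OF f l]] by blast
    have "norm (S N l) \<le> (\<Sum>j\<in>{1..n}. r ^ N)"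
      unfolding S_def y sum_mset_sym_proj
    proof (rule sum_norm_le)
      fix j assume "j \<in> {1..n}"
      hence "norm (G (y j)) \<le> r" by (intro r) (auto simp: y set_mset_sym_proj)
      thus "norm (G (y j) ^ N) \<le> r ^ N" by (simp add: norm_power power_mono)
    qed
    thus ?thesis by simp
  qed
  have S_m: "norm (S N x) \<le> of_nat n * m ^ N" for N
  proof -
    define h where "h = S N \<circ> Moebius_function 0 (-x0)"
    have M: "Moebius_function 0 (-x0) t \<in> ball 0 1" if "norm t < 1" for t
      using Moebius_function_norm_lt_1[of "-x0" t] nx0 that by simp
    have hol: "h holomorphic_on ball 0 1"
      unfolding h_def
    proof (rule holomorphic_on_compose_gen)
      show "Moebius_function 0 (-x0) holomorphic_on ball 0 1"
        using nx0 by (intro Moebius_function_holomorphic) simp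
      show "S N holomorphic_on ball 0 1"
        unfolding S_def by (intro holomorphic_sum_over_entries[OF X f] holomorphic_function_power G_hol)
    qed (use M in auto)
    have h_le: "norm (h t) \<le> of_nat n" if t: "norm t < 1" for t
    proof -
      have "norm (S N (Moebius_function 0 (-x0) t)) \<le> of_nat n * 1 ^ N"
        using holomorphic_maps_dim_sym_points[OF f M[OF t]]
        by (intro S_le M t G_le) (auto simp: sym_points_def)
      thus ?thesis by (simp add: h_def)
    qed
    have h_near: "norm (h t) \<le> (of_nat n * (2 * C) ^ N) * norm t ^ N" if t: "norm t < min 1 (d / 2)" for t
    proof -
      have t1: "norm t < 1" using t by simp
      have dist: "norm (Moebius_function 0 (-x0) t - x0) \<le> 2 * norm t"
        by (rule Moebius_function_neg_dist_le[OF nx0 t1])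
      hence "Moebius_function 0 (-x0) t \<in> ball x0 d"
        using t by (simp add: dist_norm norm_minus_commute)
      hence "norm (S N (Moebius_function 0 (-x0) t)) \<le> of_nat n * (C * (2 * norm t)) ^ N"
        using mult_left_mono[OF dist C] by (intro S_le M t1) (meson near order_trans)
      also have "\<dots> = (of_nat n * (2 * C) ^ N) * norm t ^ N"
        by (simp add: power_mult_distrib mult_ac)
      finally show ?thesis by (simp add: h_def)
    qed
    have "min 1 (d / 2) > 0" using d by simp
    from Schwarz_Lemma_order[OF hol h_le this h_near Moebius_function_norm_lt_1[OF nx0 nx]]
    have "norm (h (Moebius_function 0 x0 x)) \<le> of_nat n * m ^ N"
      unfolding m_def by blast
    moreover have "Moebius_function 0 (-x0) (Moebius_function 0 x0 x) = x"
      using Moebius_function_compose[of "-x0" x0 x] nx0 nx by simp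
    ultimately show ?thesis by (simp add: h_def)
  qed
  obtain y where y: "f x = sym_proj n y"
    using sym_points_obtain[OF holomorphic_maps_dim_sym_points[OF f x]] by blast
  obtain i where i: "i \<in> {1..n}" "a = y i" using a by (auto simp: y set_mset_sym_proj)
  have "norm (G (y i)) \<le> m"
  proof (rule norm_le_of_power_sums_le[where J = "{1..n}" and w = "\<lambda>j. G (y j)" and C = "of_nat n"])
    show "norm (\<Sum>j\<in>{1..n}. G (y j) ^ N) \<le> of_nat n * m ^ N" for N
      using S_m[of N] unfolding S_def y sum_mset_sym_proj .
  qed (use i in \<open>auto simp: m_def\<close>)
  thus ?thesis by (simp add: norm_G i(2) m_def)
qed

section \<open>Moebius distances\<close>

lemma moebius_dist_candidates:
  assumes X: "riemann_surface X" and z1: "z1 \<in> topspace (topol X)"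
  shows "{cmod (g z1) | g. g \<in> holomorphic_maps X disc \<and> g z2 = 0} \<noteq> {}"
    and "bdd_above {cmod (g z1) | g. g \<in> holomorphic_maps X disc \<and> g z2 = 0}"
proof -
  have "(\<lambda>_. 0) \<in> holomorphic_maps X disc"
    unfolding holomorphic_maps_disc_iff[OF X] by (simp add: holomorphic_function_const)
  thus "{cmod (g z1) | g. g \<in> holomorphic_maps X disc \<and> g z2 = 0} \<noteq> {}" by blast
  show "bdd_above {cmod (g z1) | g. g \<in> holomorphic_maps X disc \<and> g z2 = 0}"
    using holomorphic_maps_disc_norm_less[OF _ z1] by (intro bdd_aboveI[of _ 1]) (auto intro: less_imp_le)
qed

lemma moebius_dist_ge:
  assumes "riemann_surface X" "z1 \<in> topspace (topol X)"
    and "g \<in> holomorphic_maps X disc" "g z2 = 0"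
  shows "norm (g z1) \<le> moebius_dist X z1 z2"
  unfolding moebius_dist_def
  by (rule cSup_upper[OF _ moebius_dist_candidates(2)[OF assms(1,2)]]) (use assms(3,4) in blast)

lemma moebius_dist_approx:
  assumes "riemann_surface X" "z1 \<in> topspace (topol X)" "t < moebius_dist X z1 z2"
  obtains g where "g \<in> holomorphic_maps X disc" "g z2 = 0" "t < norm (g z1)"
  using less_cSupD[OF moebius_dist_candidates(1)[OF assms(1,2)] assms(3)[unfolded moebius_dist_def]]
  by blast

lemma moebius_dist_nonneg:
  assumes "riemann_surface X" "z1 \<in> topspace (topol X)"
  shows "moebius_dist X z1 z2 \<ge> 0"
proof -
  obtain g where "g \<in> holomorphic_maps X disc" "g z2 = 0"
    using moebius_dist_candidates(1)[OF assms] by blast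
  thus ?thesis using moebius_dist_ge[OF assms] norm_ge_zero order_trans by blast
qed

text \<open>
If \<open>g\<close> vanishes at \<open>z2\<close>, follow it by the disc automorphism that takes \<open>g z1\<close> to \<open>0\<close> and \<open>0\<close> to \<open>- g z1\<close>.
\<close>

lemma moebius_dist_commute_le:
  assumes X: "riemann_surface X" and z: "z1 \<in> topspace (topol X)" "z2 \<in> topspace (topol X)"
  shows "moebius_dist X z1 z2 \<le> moebius_dist X z2 z1"
proof (rule ccontr)
  assume "\<not> ?thesis"
  then obtain g where g: "g \<in> holomorphic_maps X disc" "g z2 = 0" and lt: "moebius_dist X z2 z1 < norm (g z1)"
    using moebius_dist_approx[OF X z(1), of "moebius_dist X z2 z1"] by (metis not_le)
  have n: "norm (g z1) < 1" by (rule holomorphic_maps_disc_norm_less[OF g(1) z(1)])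
  have "Moebius_function 0 (g z1) \<circ> g \<in> holomorphic_maps X disc"
    using n by (intro holomorphic_maps_disc_compose[OF X g(1)] Moebius_function_holomorphic Moebius_function_norm_lt_1)
  from moebius_dist_ge[OF X z(2) this] have "norm (g z1) \<le> moebius_dist X z2 z1"
    using g(2) by (simp add: Moebius_function_eq_zero Moebius_function_of_zero)
  with lt show False by simp
qed

lemma moebius_dist_commute:
  assumes "riemann_surface X" "z1 \<in> topspace (topol X)" "z2 \<in> topspace (topol X)"
  shows "moebius_dist X z1 z2 = moebius_dist X z2 z1"
  using assms by (intro antisym moebius_dist_commute_le)

lemma topspace_disc: "topspace (topol disc) = ball 0 1"
  by (simp add: disc_def)

lemma Moebius_function_le_moebius_dist_disc:
  assumes x: "x \<in> ball 0 1" and x0: "x0 \<in> ball 0 1"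
  shows "norm (Moebius_function 0 x0 x) \<le> moebius_dist disc x x0"
proof (rule moebius_dist_ge[OF riemann_surface_disc])
  have n: "norm x0 < 1" using x0 by simp
  have hol: "Moebius_function 0 x0 holomorphic_on ball 0 1" by (rule Moebius_function_holomorphic[OF n])
  hence "continuous_map (topol disc) (top_of_set (ball 0 1)) (Moebius_function 0 x0)"
    using Moebius_function_norm_lt_1[OF n] by (auto simp: disc_def intro: holomorphic_on_imp_continuous_on)
  moreover have "holomorphic_function disc (Moebius_function 0 x0)"
  proof -
    have "(Moebius_function 0 x0 \<circ> inv_into (ball 0 1) (\<lambda>z. z)) holomorphic_on ball 0 1"
      by (rule holomorphic_transform[OF hol]) (simp add: inv_into_identity)
    thus ?thesis by (simp add: holomorphic_function_def disc_def)
  qed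
  ultimately show "Moebius_function 0 x0 \<in> holomorphic_maps disc disc"
    unfolding holomorphic_maps_disc_iff[OF riemann_surface_disc] ..
qed (use x x0 in \<open>simp_all only: topspace_disc Moebius_function_eq_zero\<close>)

text \<open>
For each entry \<open>b\<close> of \<open>f x0\<close> take its own function \<open>g b\<close> that almost attains the distance of \<open>a\<close> and \<open>b\<close>.
The minimum to the power \<open>n\<close> is then dominated by the product of the \<open>n\<close> numbers \<open>norm (g b a)\<close>.
\<close>

lemma Min_moebius_dist_power_le:
  assumes X: "riemann_surface X" and n: "n \<ge> 1" and f: "f \<in> holomorphic_maps_dim n disc (Sym n X)"
    and x: "x \<in> ball 0 1" and x0: "x0 \<in> ball 0 1" and a: "a \<in># f x"
  shows "(Min ((\<lambda>b. moebius_dist X a b) ` set_mset (f x0))) ^ n \<le> moebius_dist disc x x0"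
    (is "?d ^ n \<le> ?m")
proof (rule ccontr)
  assume "\<not> ?thesis"
  hence lt: "?m < ?d ^ n" by simp
  have pts: "f x \<in> sym_points n (topspace (topol X))" "f x0 \<in> sym_points n (topspace (topol X))"
    using holomorphic_maps_dim_sym_points[OF f] x x0 by blast+
  have aT: "a \<in> topspace (topol X)" and bT: "\<And>b. b \<in># f x0 \<Longrightarrow> b \<in> topspace (topol X)"
    using pts a by (auto simp: sym_points_def)
  have ne: "f x0 \<noteq> {#}" using pts(2) n by (auto simp: sym_points_def)
  have m0: "?m \<ge> 0" using x x0 by (intro moebius_dist_nonneg riemann_surface_disc) (auto simp: topspace_disc)
  have d0: "?d \<ge> 0" using ne moebius_dist_nonneg[OF X aT] by (auto simp: Min_ge_iff)
  have "root n ?m < ?d"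
    using real_root_less_mono[OF _ lt, of n] n d0 by (simp add: real_root_power_cancel)
  then obtain t where t: "root n ?m < t" "t < ?d" using dense by blast
  have t0: "t > 0" using t(1) m0 n real_root_ge_zero[of ?m n] by linarith
  have "?m = root n ?m ^ n" using n m0 by (simp add: real_root_pow_pos2)
  also have "\<dots> < t ^ n" using t(1) n m0 by (intro power_strict_mono) auto
  finally have mt: "?m < t ^ n" .
  have "\<exists>g. g \<in> holomorphic_maps X disc \<and> g b = 0 \<and> t < norm (g a)" if b: "b \<in># f x0" for b
  proof -
    have "?d \<le> moebius_dist X a b" using b by (intro Min_le) auto
    hence "t < moebius_dist X a b" using t(2) by simp
    thus ?thesis using moebius_dist_approx[OF X aT] by metis
  qed
  then obtain g where g: "\<And>b. b \<in># f x0 \<Longrightarrow> g b \<in> holomorphic_maps X disc \<and> g b b = 0"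
    and gt: "\<And>b. b \<in># f x0 \<Longrightarrow> t < norm (g b a)" by metis
  obtain b where fx0: "f x0 = sym_proj n b" using sym_points_obtain[OF pts(2)] by blast
  have "t ^ n = (\<Prod>j\<in>{1..n}. t)" by simp
  also have "\<dots> \<le> (\<Prod>j\<in>{1..n}. norm (g (b j) a))"
    using t0 gt by (intro prod_mono conjI less_imp_le) (auto simp: fx0 set_mset_sym_proj)
  also have "\<dots> = (\<Prod>b\<in>#f x0. norm (g b a))" unfolding fx0 prod_mset_sym_proj ..
  also have "\<dots> \<le> norm (Moebius_function 0 x0 x)"
    by (rule prod_over_entries_le_Moebius[OF X f x x0 a g])
  also have "\<dots> \<le> ?m" by (rule Moebius_function_le_moebius_dist_disc[OF x x0])
  finally show False using mt by simp
qed

theorem theorem1: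
  fixes X :: "'a surface" and n :: nat and f :: "complex \<Rightarrow> 'a multiset"
  assumes "riemann_surface X" and "n \<ge> 1"
    and "f \<in> holomorphic_maps_dim n disc (Sym n X)"
  shows "\<forall>x \<in> ball 0 1. \<forall>x0 \<in> ball 0 1.
           (hausdorff_dist (moebius_dist X) (set_mset (f x)) (set_mset (f x0))) ^ n \<le> moebius_dist disc x x0"
proof (intro ballI)
  fix x x0 :: complex assume x: "x \<in> ball 0 1" and x0: "x0 \<in> ball 0 1"
  let ?A = "set_mset (f x)" and ?B = "set_mset (f x0)"
  have pts: "f y \<in> sym_points n (topspace (topol X))" if "y \<in> ball 0 1" for y
    using holomorphic_maps_dim_sym_points[OF assms(3) that] .
  have ne: "f y \<noteq> {#}" if "y \<in> ball 0 1" for y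
    using pts[OF that] assms(2) by (auto simp: sym_points_def)
  have sub: "set_mset (f y) \<subseteq> topspace (topol X)" if "y \<in> ball 0 1" for y
    using pts[OF that] by (simp add: sym_points_def)
  have 1: "(Min ((\<lambda>b. moebius_dist X a b) ` ?B)) ^ n \<le> moebius_dist disc x x0" if "a \<in> ?A" for a
    by (rule Min_moebius_dist_power_le[OF assms x x0 that])
  have 2: "(Min ((\<lambda>a. moebius_dist X a b) ` ?A)) ^ n \<le> moebius_dist disc x x0" if b: "b \<in> ?B" for b
  proof -
    have "(\<lambda>a. moebius_dist X a b) ` ?A = (\<lambda>a. moebius_dist X b a) ` ?A"
      using sub[OF x] sub[OF x0] b by (intro image_cong refl moebius_dist_commute[OF assms(1)]) auto
    moreover have "moebius_dist disc x x0 = moebius_dist disc x0 x"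
      using x x0 by (intro moebius_dist_commute riemann_surface_disc) (simp_all only: topspace_disc)
    ultimately show ?thesis using Min_moebius_dist_power_le[OF assms x0 x b] by simp
  qed
  have "Max ((\<lambda>a. Min ((\<lambda>b. moebius_dist X a b) ` ?B)) ` ?A) \<in> (\<lambda>a. Min ((\<lambda>b. moebius_dist X a b) ` ?B)) ` ?A"
       "Max ((\<lambda>b. Min ((\<lambda>a. moebius_dist X a b) ` ?A)) ` ?B) \<in> (\<lambda>b. Min ((\<lambda>a. moebius_dist X a b) ` ?A)) ` ?B"
    using ne[OF x] ne[OF x0] by (intro Max_in; simp)+
  thus "(hausdorff_dist (moebius_dist X) ?A ?B) ^ n \<le> moebius_dist disc x x0"
    unfolding hausdorff_dist_def max_def using 1 2 by auto
qed

end
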